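(* Let $d\ge1$, let $\alpha\in\mathbb{T}^d$ be rationally independent and $\lambda\in\mathbb{C}$. Let $V\in C(\mathbb{T}^d,\mathbb{C})$ be Hölder continuous with $\log|z-V(\cdot)|\in L^1(\mathbb{T}^d)$ for all $z\in\mathbb{C}$. Then the operator $\widehat H^V_\alpha(\lambda,\theta)$ on $\ell^2(\mathbb{Z})$ given by $$(\widehat H^V_\alpha(\lambda,\theta)u)(n)=\lambda u(n-1)+V(\theta+n\alpha)u(n),\quad n\in\mathbb{Z},$$ satisfies $$\sigma(\widehat H^V_\alpha(\lambda,\theta))=S_\lambda\qquad\text{for all }\theta\in\mathbb{T}^d.$$
   Context: $\mathbb{T}=\mathbb{R}/\mathbb{Z}$. A vector $\alpha\in\mathbb{T}^d$ is rationally independent if $(1,\alpha_1,\dots,\alpha_d)$ is linearly independent over $\mathbb{Q}$. Put $G_d(z)=\int_{\mathbb{T}^d}\log|z-V(\theta)|\,d\theta$ and let $R(V)$ be the range of $V$. For $\lambda\in\mathbb{C}\setminus\{0\}$ put $$P_\lambda=\{z\in\mathbb{C}: G_d(z)=\log|\lambda|\},\quad C_\lambda=\{z\in\mathbb{C}: G_d(z)>\log|\lambda|\}\cap R(V),\quad S_\lambda=P_\lambda\cup C_\lambda,$$ and put $S_0=R(V)$. *)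

theory Defs
  imports "HOL-Analysis.Analysis"
begin

text \<open>
  The torus is \<open>(\<real>/\<int>)^d\<close>, with \<open>d = CARD('d)\<close>. Its points are given by representatives in
  \<^typ>\<open>real ^ 'd\<close>, and functions on it are the functions on \<^typ>\<open>real ^ 'd\<close> that are invariant
  under translation by integer vectors.
\<close>

definition int_lattice :: "(real ^ 'd) set" where
  "int_lattice = {k. \<forall>i. k $ i \<in> \<int>}"

definition torus_function :: "(real ^ 'd \<Rightarrow> complex) \<Rightarrow> bool" where
  "torus_function V \<longleftrightarrow> (\<forall>x. \<forall>k \<in> int_lattice. V (x + k) = V x)"

definition torus_dist :: "real ^ 'd \<Rightarrow> real ^ 'd \<Rightarrow> real" where
  "torus_dist x y = infdist (x - y) int_lattice"

definition holder_continuous :: "(real ^ 'd \<Rightarrow> complex) \<Rightarrow> bool" where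
  "holder_continuous V \<longleftrightarrow>
     (\<exists>C \<gamma>. 0 < \<gamma> \<and> \<gamma> \<le> 1 \<and> (\<forall>x y. dist (V x) (V y) \<le> C * torus_dist x y powr \<gamma>))"

definition rationally_independent :: "real ^ 'd \<Rightarrow> bool" where
  "rationally_independent \<alpha> \<longleftrightarrow>
     (\<forall>(q\<^sub>0 :: rat) (q :: 'd \<Rightarrow> rat).
        of_rat q\<^sub>0 + (\<Sum>i\<in>UNIV. of_rat (q i) * \<alpha> $ i) = 0 \<longrightarrow> q\<^sub>0 = 0 \<and> (\<forall>i. q i = 0))"

definition unit_cube :: "(real ^ 'd) set" where
  "unit_cube = cbox 0 (\<chi> i. 1)"

text \<open>
  The logarithm takes the value \<open>-\<infinity>\<close> at \<open>0\<close>, so integrability of \<open>log |z - V|\<close> includes that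
  \<open>V \<noteq> z\<close> almost everywhere. As \<^term>\<open>ln (0 :: real) = 0\<close> in HOL, this has to be required
  separately.
\<close>

definition log_dist_integrable :: "(real ^ 'd \<Rightarrow> complex) \<Rightarrow> complex \<Rightarrow> bool" where
  "log_dist_integrable V z \<longleftrightarrow>
     (AE x in lborel. x \<in> unit_cube \<longrightarrow> V x \<noteq> z) \<and>
     set_integrable lborel unit_cube (\<lambda>x. ln (cmod (z - V x)))"

definition G :: "(real ^ 'd \<Rightarrow> complex) \<Rightarrow> complex \<Rightarrow> real" where
  "G V z = (LINT x:unit_cube|lborel. ln (cmod (z - V x)))"

definition P_set :: "(real ^ 'd \<Rightarrow> complex) \<Rightarrow> complex \<Rightarrow> complex set" where
  "P_set V l = {z. G V z = ln (cmod l)}"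

definition C_set :: "(real ^ 'd \<Rightarrow> complex) \<Rightarrow> complex \<Rightarrow> complex set" where
  "C_set V l = {z. G V z > ln (cmod l)} \<inter> range V"

definition S_set :: "(real ^ 'd \<Rightarrow> complex) \<Rightarrow> complex \<Rightarrow> complex set" where
  "S_set V l = (if l = 0 then range V else P_set V l \<union> C_set V l)"

definition ell2 :: "(int \<Rightarrow> complex) set" where
  "ell2 = {u. (\<lambda>n. (cmod (u n))\<^sup>2) summable_on UNIV}"

definition ell2_norm :: "(int \<Rightarrow> complex) \<Rightarrow> real" where
  "ell2_norm u = sqrt (\<Sum>\<^sub>\<infinity>n. (cmod (u n))\<^sup>2)"

text \<open>Operators are functions on all sequences; only their restriction to \<^const>\<open>ell2\<close> matters.\<close>

definition bounded_operator :: "((int \<Rightarrow> complex) \<Rightarrow> (int \<Rightarrow> complex)) \<Rightarrow> bool" where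
  "bounded_operator T \<longleftrightarrow>
     (\<forall>u\<in>ell2. T u \<in> ell2) \<and>
     (\<forall>u\<in>ell2. \<forall>v\<in>ell2. T (\<lambda>n. u n + v n) = (\<lambda>n. T u n + T v n)) \<and>
     (\<forall>c. \<forall>u\<in>ell2. T (\<lambda>n. c * u n) = (\<lambda>n. c * T u n)) \<and>
     (\<exists>K. \<forall>u\<in>ell2. ell2_norm (T u) \<le> K * ell2_norm u)"

definition resolvent_set :: "((int \<Rightarrow> complex) \<Rightarrow> (int \<Rightarrow> complex)) \<Rightarrow> complex set" where
  "resolvent_set T =
     {z. \<exists>R. bounded_operator R \<and>
           (\<forall>u\<in>ell2. R (\<lambda>n. T u n - z * u n) = u \<and> (\<lambda>n. T (R u) n - z * R u n) = u)}"

definition op_spectrum :: "((int \<Rightarrow> complex) \<Rightarrow> (int \<Rightarrow> complex)) \<Rightarrow> complex set" where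
  "op_spectrum T = - resolvent_set T"

definition H_op ::
  "(real ^ 'd \<Rightarrow> complex) \<Rightarrow> real ^ 'd \<Rightarrow> complex \<Rightarrow> real ^ 'd \<Rightarrow> (int \<Rightarrow> complex) \<Rightarrow> int \<Rightarrow> complex"
  where
  "H_op V \<alpha> l \<theta> u = (\<lambda>n. l * u (n - 1) + V (\<theta> + of_int n *\<^sub>R \<alpha>) * u n)"

end

theory Submission
  imports Defs
begin

text \<open>
  Write \<open>A = (z - V) / l\<close> and \<open>A\<^sub>n = A (\<theta> + n \<alpha>)\<close>, for \<open>l \<noteq> 0\<close>. The equation \<open>(H - z) u = f\<close> reads
  \<open>u (n - 1) = f n / l + A\<^sub>n * u n\<close>: a scalar weighted shift, whose iterates are products of \<open>A\<close> along
  the orbit of the rotation by \<open>\<alpha>\<close>. The average growth rate of these products is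
  \<open>\<integral> ln \<bar>A\<bar> = G V z - ln \<bar>l\<bar>\<close>, and everything depends on its sign and on whether \<open>A\<close> has a zero, that is,
  on whether \<open>z\<close> is a value of \<open>V\<close>.

  \<^item> If the rate is negative, or if it is positive and \<open>A\<close> has no zero, then the products of \<open>A\<close>,
    respectively of \<open>1 / A\<close>, decay exponentially, uniformly in the starting point: the rotation is
    uniquely ergodic, and in the first case \<open>ln \<bar>A\<bar>\<close> is the limit from above of continuous functions.
    A geometric series then inverts \<open>H - z\<close> (\<open>resolvent_if_G_less\<close>, \<open>resolvent_if_G_greater\<close>).
  \<^item> If the rate is zero and \<open>A\<close> has no zero, the solution of the homogeneous equation grows
    subexponentially in both directions, and damping it by a slowly decaying exponential gives
    approximate eigenvectors (\<open>spectrum_critical\<close>).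
  \<^item> If the rate is at least zero and \<open>A\<close> vanishes at \<open>x\<^sub>0\<close>, suppose that \<open>H - z\<close> has a bounded inverse.
    Near a visit of the orbit to \<open>x\<^sub>0\<close> the two half lines decouple, so to the left of such a visit the
    columns of the inverse are the bare products of \<open>A\<close>. These are therefore square summable with a
    uniform bound, first along the backward orbit of \<open>x\<^sub>0\<close> and then, by density and continuity, for
    every starting point. But by Jensen's inequality the mean square of a product of length \<open>m\<close> is at
    least \<open>1\<close> for every \<open>m\<close>, a contradiction (\<open>spectrum_on_range\<close>).

  For \<open>l = 0\<close> the operator is the multiplication by \<open>V\<close> along a dense orbit
  (\<open>spectrum_multiplication\<close>).

  Density of the orbit comes from Kronecker's approximation theorem, and compactness makes it uniform.
  Uniform equidistribution follows without Fourier series: Birkhoff sums change by a bounded amount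
  under a bounded number of rotation steps, and boundedly many steps bring any point close to any other,
  so a Birkhoff average is nearly constant and equals the integral up to a small error.
\<close>

section \<open>Lattice-periodic functions and dense orbits\<close>

definition lattice_periodic :: "(real ^ 'd \<Rightarrow> 'a) \<Rightarrow> bool" where
  "lattice_periodic f \<longleftrightarrow> (\<forall>x. \<forall>k\<in>int_lattice. f (x + k) = f x)"

lemma lattice_periodicD: "lattice_periodic f \<Longrightarrow> k \<in> int_lattice \<Longrightarrow> f (x + k) = f x"
  by (simp add: lattice_periodic_def)

lemma lattice_periodic_compose: "lattice_periodic f \<Longrightarrow> lattice_periodic (\<lambda>x. h (f x))"
  by (simp add: lattice_periodic_def)

lemma lattice_periodic_shift:
  assumes "lattice_periodic f"
  shows "lattice_periodic (\<lambda>x. f (x + t))"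
proof -
  have "f (x + k + t) = f (x + t)" if "k \<in> int_lattice" for x k
    using lattice_periodicD[OF assms that, of "x + t"] by (simp add: algebra_simps)
  then show ?thesis by (simp add: lattice_periodic_def)
qed

lemma unit_cube_representative:
  fixes y :: "real ^ 'd"
  obtains m where "m \<in> int_lattice" "y - m \<in> unit_cube"
proof
  let ?m = "\<chi> i. of_int \<lfloor>y $ i\<rfloor> :: real ^ 'd"
  show "?m \<in> int_lattice" by (simp add: int_lattice_def)
  show "y - ?m \<in> unit_cube"
    unfolding unit_cube_def mem_box_cart
  proof
    fix i
    show "(0::real ^ 'd) $ i \<le> (y - ?m) $ i \<and> (y - ?m) $ i \<le> (\<chi> i. 1) $ i"
      using floor_correct[of "y $ i"] by (simp del: floor_correct) linarith
  qed
qed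

text \<open>
  Translates rational independence into the form that Kronecker's theorem expects: the numbers
  \<open>\<alpha>\<^sub>1, \<dots>, \<alpha>\<^sub>d, 1\<close>, enumerated with \<open>1\<close> last, are distinct and independent over \<open>\<int>\<close>.
\<close>

lemma rationally_independent_module_independent:
  fixes \<alpha> :: "real ^ 'd" and b :: "nat \<Rightarrow> 'd" and n :: nat
  defines "t \<equiv> \<lambda>i. if i < n then \<alpha> $ b i else 1"
  assumes ri: "rationally_independent \<alpha>" and b: "bij_betw b {..<n} UNIV"
  shows "inj_on t {..n}" and "module.independent (\<lambda>r x. of_int r * x) (t ` {..n})"
proof -
  have rat0: "q0 = 0 \<and> (\<forall>i. q i = 0)"
    if "of_rat q0 + (\<Sum>i\<in>UNIV. of_rat (q i) * \<alpha> $ i) = 0" for q0 :: rat and q :: "'d \<Rightarrow> rat"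
    using ri that unfolding rationally_independent_def by blast
  have inj_comp: "i = j" if "\<alpha> $ i = \<alpha> $ j" for i j
  proof (rule ccontr)
    assume ne: "i \<noteq> j"
    define q :: "'d \<Rightarrow> rat" where "q k = (if k = i then 1 else 0) - (if k = j then 1 else 0)" for k
    have "(\<Sum>k\<in>UNIV. of_rat (q k) * \<alpha> $ k)
        = (\<Sum>k\<in>UNIV. (if k = i then \<alpha> $ k else 0) - (if k = j then \<alpha> $ k else 0))"
      by (rule sum.cong) (auto simp: q_def)
    also have "\<dots> = 0" using that by (simp add: sum_subtractf)
    finally have "q i = 0" using rat0[of 0 q] by simp
    then show False using ne by (simp add: q_def)
  qed
  have comp_ne_1: "\<alpha> $ i \<noteq> 1" for i
  proof
    assume 1: "\<alpha> $ i = 1"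
    define q :: "'d \<Rightarrow> rat" where "q k = (if k = i then 1 else 0)" for k
    have "(\<Sum>k\<in>UNIV. of_rat (q k) * \<alpha> $ k) = (\<Sum>k\<in>UNIV. (if k = i then \<alpha> $ k else 0))"
      by (rule sum.cong) (auto simp: q_def)
    also have "\<dots> = 1" using 1 by simp
    finally show False using rat0[of "-1" q] by simp
  qed
  show inj: "inj_on t {..n}"
    using b comp_ne_1 comp_ne_1[symmetric]
    by (auto simp: inj_on_def t_def bij_betw_def dest!: inj_comp)
  interpret Modules.module "(\<lambda>r x. of_int r * x :: real)"
    by unfold_locales (auto simp: algebra_simps)
  show "independent (t ` {..n})"
    unfolding independent_explicit_module
  proof (intro allI impI)
    fix T u v
    assume T: "finite T" "T \<subseteq> t ` {..n}" "(\<Sum>v\<in>T. of_int (u v) * v) = 0" "v \<in> T"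
    define w where "w v = (if v \<in> T then u v else 0)" for v
    have "0 = (\<Sum>v\<in>t ` {..n}. of_int (w v) * v)"
      unfolding T(3)[symmetric] w_def using T(2) by (intro sum.mono_neutral_cong_left) auto
    also have "\<dots> = (\<Sum>i\<le>n. of_int (w (t i)) * t i)"
      using inj by (simp add: sum.reindex)
    also have "\<dots> = of_int (w 1) + (\<Sum>i<n. of_int (w (\<alpha> $ b i)) * \<alpha> $ b i)"
      by (simp add: t_def lessThan_Suc_atMost[symmetric])
    also have "(\<Sum>i<n. of_int (w (\<alpha> $ b i)) * \<alpha> $ b i) = (\<Sum>j\<in>UNIV. of_int (w (\<alpha> $ j)) * \<alpha> $ j)"
      using b by (rule sum.reindex_bij_betw)
    finally have "w 1 = 0" "\<And>j. w (\<alpha> $ j) = 0"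
      using rat0[of "of_int (w 1)" "\<lambda>j. of_int (w (\<alpha> $ j))"] by auto
    moreover have "v = 1 \<or> (\<exists>j. v = \<alpha> $ j)"
      using T(2,4) by (auto simp: t_def split: if_splits)
    ultimately have "w v = 0" by metis
    then show "u v = 0" using T(4) by (simp add: w_def)
  qed
qed

lemma orbit_dense_mod_lattice:
  fixes \<alpha> y :: "real ^ 'd"
  assumes ri: "rationally_independent \<alpha>" and \<epsilon>: "0 < \<epsilon>"
  obtains k :: int and m where "m \<in> int_lattice" "dist (of_int k *\<^sub>R \<alpha> + m) y < \<epsilon>"
proof -
  define n where "n = CARD('d)"
  have n: "0 < n" by (simp add: n_def)
  obtain b :: "nat \<Rightarrow> 'd" where b: "bij_betw b {..<n} UNIV"
    using ex_bij_betw_nat_finite[of "UNIV :: 'd set"] by (auto simp: n_def atLeast0LessThan)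
  define t where "t i = (if i < n then \<alpha> $ b i else 1)" for i
  have t: "inj_on t {..n}" "module.independent (\<lambda>r x. of_int r * x) (t ` {..n})"
    using rationally_independent_module_independent[OF ri b] unfolding t_def[abs_def] by auto
  obtain k h where h: "\<And>i. i < n \<Longrightarrow> \<bar>of_int k * t i - of_int (h i) - y $ b i\<bar> < \<epsilon> / n"
    using Kronecker_thm_2[OF t(2,1), of "\<epsilon> / n" "\<lambda>i. y $ b i"] n \<epsilon> by (auto simp: t_def)
  define m :: "real ^ 'd" where "m = (\<chi> j. - of_int (h (the_inv_into {..<n} b j)))"
  have "\<bar>(of_int k *\<^sub>R \<alpha> + m - y) $ j\<bar> < \<epsilon> / n" for j
  proof -
    obtain i where i: "i < n" "j = b i" using b by (metis UNIV_I bij_betw_def imageE lessThan_iff)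
    have "the_inv_into {..<n} b j = i"
      using b i by (simp add: bij_betw_def the_inv_into_f_f)
    then show ?thesis using h[OF i(1)] i by (simp add: m_def t_def algebra_simps)
  qed
  then have "(\<Sum>j\<in>UNIV. \<bar>(of_int k *\<^sub>R \<alpha> + m - y) $ j\<bar>) < (\<Sum>j\<in>(UNIV::'d set). \<epsilon> / n)"
    by (intro sum_strict_mono) auto
  also have "\<dots> = \<epsilon>" using n by (simp add: n_def)
  finally have "dist (of_int k *\<^sub>R \<alpha> + m) y < \<epsilon>"
    unfolding dist_norm using norm_le_l1_cart order_le_less_trans by blast
  moreover have "m \<in> int_lattice" by (simp add: m_def int_lattice_def)
  ultimately show ?thesis using that by blast
qed

text \<open>
  The cube is compact, so finitely many points of the orbit already form an \<open>\<epsilon>\<close>-net of the torus.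
\<close>

lemma orbit_uniformly_dense:
  fixes \<alpha> :: "real ^ 'd"
  assumes ri: "rationally_independent \<alpha>" and \<epsilon>: "0 < \<epsilon>"
  obtains K :: nat where
    "\<And>y. \<exists>(k::int) m. \<bar>k\<bar> \<le> int K \<and> m \<in> int_lattice \<and> dist (of_int k *\<^sub>R \<alpha> + m) y < \<epsilon>"
proof -
  let ?c = "\<lambda>p. of_int (fst p) *\<^sub>R \<alpha> + snd p"
  have "unit_cube \<subseteq> (\<Union>p\<in>UNIV \<times> int_lattice. ball (?c p) \<epsilon>)"
  proof
    fix y :: "real ^ 'd"
    obtain k m where "m \<in> int_lattice" "dist (of_int k *\<^sub>R \<alpha> + m) y < \<epsilon>"
      using orbit_dense_mod_lattice[OF ri \<epsilon>] .
    then show "y \<in> (\<Union>p\<in>UNIV \<times> int_lattice. ball (?c p) \<epsilon>)"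
      by (intro UN_I[of "(k, m)"]) auto
  qed
  then obtain C where C: "C \<subseteq> UNIV \<times> int_lattice" "finite C" "unit_cube \<subseteq> (\<Union>p\<in>C. ball (?c p) \<epsilon>)"
    by (rule compactE_image[rotated 2]) (auto simp: unit_cube_def)
  define K where "K = nat (\<Sum>p\<in>C. \<bar>fst p\<bar>)"
  have "\<exists>(k::int) m. \<bar>k\<bar> \<le> int K \<and> m \<in> int_lattice \<and> dist (of_int k *\<^sub>R \<alpha> + m) y < \<epsilon>" for y
  proof -
    obtain m0 where m0: "m0 \<in> int_lattice" "y - m0 \<in> unit_cube"
      using unit_cube_representative .
    then obtain p where p: "p \<in> C" "dist (?c p) (y - m0) < \<epsilon>" using C(3) by auto
    have "\<bar>fst p\<bar> \<le> (\<Sum>p\<in>C. \<bar>fst p\<bar>)" using p(1) C(2) by (intro member_le_sum) auto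
    moreover have "snd p + m0 \<in> int_lattice" using p(1) C(1) m0(1) by (auto simp: int_lattice_def)
    moreover have "dist (of_int (fst p) *\<^sub>R \<alpha> + (snd p + m0)) y < \<epsilon>"
      using p(2) by (simp add: dist_norm algebra_simps)
    ultimately show ?thesis unfolding K_def by (intro exI[of _ "fst p"] exI[of _ "snd p + m0"]) auto
  qed
  then show ?thesis using that by blast
qed

text \<open>
  A half orbit is dense as well: as the \<open>2 K + 1\<close> consecutive points of the orbit segment around any
  point form an \<open>\<epsilon>\<close>-net, one can use the segment around \<open>x - (K + 1) \<alpha>\<close>, which lies entirely in the
  backward orbit of \<open>x\<close>.
\<close>

lemma closed_backward_orbit_UNIV:
  fixes \<alpha> x y :: "real ^ 'd"
  assumes ri: "rationally_independent \<alpha>" and S: "closed S"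
    and per: "\<And>y m. y \<in> S \<Longrightarrow> m \<in> int_lattice \<Longrightarrow> y + m \<in> S"
    and orb: "\<And>j::nat. 1 \<le> j \<Longrightarrow> x - of_nat j *\<^sub>R \<alpha> \<in> S"
  shows "y \<in> S"
proof -
  have "\<exists>s\<in>S. dist s y < \<epsilon>" if pos: "0 < \<epsilon>" for \<epsilon>
  proof -
    obtain K where K: "\<And>y. \<exists>(k::int) m. \<bar>k\<bar> \<le> int K \<and> m \<in> int_lattice \<and>
        dist (of_int k *\<^sub>R \<alpha> + m) y < \<epsilon>"
      using orbit_uniformly_dense[OF ri pos] by blast
    obtain k m where k: "\<bar>k\<bar> \<le> int K" "m \<in> int_lattice"
      "dist (of_int k *\<^sub>R \<alpha> + m) (y - x + of_nat (K + 1) *\<^sub>R \<alpha>) < \<epsilon>"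
      using K[of "y - x + of_nat (K + 1) *\<^sub>R \<alpha>"] by blast
    define j where "j = nat (int K + 1 - k)"
    have j: "1 \<le> j" "real j = real (K + 1) - of_int k" using k(1) by (auto simp: j_def)
    have "x - of_nat j *\<^sub>R \<alpha> + m \<in> S" using per orb j(1) k(2) by blast
    moreover have "x - of_nat j *\<^sub>R \<alpha> + m - y
        = of_int k *\<^sub>R \<alpha> + m - (y - x + of_nat (K + 1) *\<^sub>R \<alpha>)"
      unfolding j(2) by (simp add: algebra_simps)
    ultimately show ?thesis using k(3) by (metis dist_norm)
  qed
  then show ?thesis using S closure_approachable closure_closed by blast
qed

section \<open>Translation invariance of the integral over the torus\<close>

text \<open>
  Unlike the closed cube, the half-open cube is an exact fundamental domain: its lattice translates
  cover every point exactly once, not just almost every point.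
\<close>

definition half_open_cube :: "(real ^ 'd) set" where
  "half_open_cube = {x. \<forall>i. 0 \<le> x $ i \<and> x $ i < 1}"

definition lattice_point :: "('d \<Rightarrow> int) \<Rightarrow> real ^ 'd" where
  "lattice_point k = (\<chi> i. of_int (k i))"

lemma lattice_point_in_int_lattice: "lattice_point k \<in> int_lattice"
  by (simp add: lattice_point_def int_lattice_def)

lemma half_open_cube_borel [measurable]: "half_open_cube \<in> sets borel"
  unfolding half_open_cube_def by measurable

lemma half_open_cube_translate_iff:
  "x + lattice_point k \<in> half_open_cube \<longleftrightarrow> k = (\<lambda>i. - \<lfloor>x $ i\<rfloor>)"
proof -
  have "0 \<le> x $ i + of_int (k i) \<and> x $ i + of_int (k i) < 1 \<longleftrightarrow> k i = - \<lfloor>x $ i\<rfloor>" for i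
    by linarith
  then show ?thesis by (simp add: half_open_cube_def lattice_point_def fun_eq_iff)
qed

lemma lattice_translates_partition:
  fixes x :: "real ^ 'd"
  shows
  "(\<integral>\<^sup>+k. indicator half_open_cube (x + lattice_point k) \<partial>count_space UNIV) = 1"
proof -
  have "(\<lambda>k. indicator half_open_cube (x + lattice_point k) :: ennreal)
      = indicator {\<lambda>i. - \<lfloor>x $ i\<rfloor>}"
    by (auto simp: fun_eq_iff indicator_def half_open_cube_translate_iff)
  then show ?thesis by simp
qed

lemma lattice_translates_partition_minus:
  fixes x :: "real ^ 'd"
  shows
  "(\<integral>\<^sup>+k. indicator half_open_cube (x - lattice_point k) \<partial>count_space UNIV) = 1"
proof -
  have "bij_betw (\<lambda>k i. - k i) (UNIV :: ('d \<Rightarrow> int) set) UNIV"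
    by (rule bij_betwI[of _ _ _ "\<lambda>k i. - k i"]) auto
  from nn_integral_bij_count_space[OF this, of "\<lambda>k. indicator half_open_cube (x + lattice_point k)"]
  have "(\<integral>\<^sup>+k. indicator half_open_cube (x + lattice_point (\<lambda>i. - k i)) \<partial>count_space UNIV) = 1"
    by (simp add: lattice_translates_partition)
  moreover have "lattice_point (\<lambda>i. - k i) = - lattice_point k" for k :: "'d \<Rightarrow> int"
    by (simp add: lattice_point_def vec_eq_iff)
  ultimately show ?thesis by simp
qed

lemma nn_integral_lborel_translate:
  fixes c :: "real ^ 'd"
  assumes "f \<in> borel_measurable borel"
  shows "(\<integral>\<^sup>+x. f (x + c) \<partial>lborel) = (\<integral>\<^sup>+x. f x \<partial>lborel)"
proof -
  have "(\<integral>\<^sup>+x. f x \<partial>lborel) = (\<integral>\<^sup>+x. f x \<partial>distr lborel borel ((+) c))"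
    by (simp add: lborel_distr_plus)
  also have "\<dots> = (\<integral>\<^sup>+x. f (x + c) \<partial>lborel)"
    using assms by (subst nn_integral_distr) (auto simp: add.commute)
  finally show ?thesis by simp
qed

text \<open>
  The usual argument for two fundamental domains: cut the cube translated by \<open>t\<close> along the lattice
  translates of the cube, and move each piece back into the cube by a lattice vector, which does not
  change the values of \<open>f\<close>.
\<close>

lemma nn_integral_half_open_cube_translate:
  fixes f :: "real ^ 'd \<Rightarrow> ennreal"
  assumes f [measurable]: "f \<in> borel_measurable borel" and per: "lattice_periodic f"
  shows "(\<integral>\<^sup>+x. f (x + t) * indicator half_open_cube x \<partial>lborel)
       = (\<integral>\<^sup>+x. f x * indicator half_open_cube x \<partial>lborel)"
proof -
  let ?Q = "half_open_cube :: (real ^ 'd) set" and ?C = "count_space (UNIV :: ('d \<Rightarrow> int) set)"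
  interpret pair_sigma_finite ?C "lborel :: (real ^ 'd) measure"
    by (intro pair_sigma_finite.intro sigma_finite_measure_count_space_countable
        lborel.sigma_finite_measure_axioms) auto
  have exch: "(\<integral>\<^sup>+x. \<integral>\<^sup>+k. h k x \<partial>?C \<partial>lborel) = (\<integral>\<^sup>+k. \<integral>\<^sup>+x. h k x \<partial>lborel \<partial>?C)"
    if [measurable]: "\<And>k. h k \<in> borel_measurable borel" for h :: "('d \<Rightarrow> int) \<Rightarrow> real ^ 'd \<Rightarrow> ennreal"
  proof -
    have "(\<lambda>(k, x). h k x) \<in> borel_measurable (?C \<Otimes>\<^sub>M lborel)"
      by (intro measurable_pair_measure_countable1) auto
    then show ?thesis by (rule Fubini')
  qed
  have "(\<integral>\<^sup>+x. f (x + t) * indicator ?Q x \<partial>lborel) = (\<integral>\<^sup>+x. f x * indicator ?Q (x - t) \<partial>lborel)"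
    using nn_integral_lborel_translate[of "\<lambda>x. f x * indicator ?Q (x - t)" t] by simp
  also have "\<dots> = (\<integral>\<^sup>+x. \<integral>\<^sup>+k. f x * indicator ?Q (x - t) * indicator ?Q (x - lattice_point k) \<partial>?C \<partial>lborel)"
    by (simp add: nn_integral_cmult lattice_translates_partition_minus)
  also have "\<dots> = (\<integral>\<^sup>+k. \<integral>\<^sup>+x. f x * indicator ?Q (x - t) * indicator ?Q (x - lattice_point k) \<partial>lborel \<partial>?C)"
    by (rule exch) simp
  also have "\<dots> = (\<integral>\<^sup>+k. \<integral>\<^sup>+x. f x * indicator ?Q x * indicator ?Q (x - t + lattice_point k) \<partial>lborel \<partial>?C)"
  proof (rule nn_integral_cong)
    fix k :: "'d \<Rightarrow> int"
    have "(\<integral>\<^sup>+x. f x * indicator ?Q (x - t) * indicator ?Q (x - lattice_point k) \<partial>lborel)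
        = (\<integral>\<^sup>+x. f (x + lattice_point k) * indicator ?Q (x + lattice_point k - t) * indicator ?Q x \<partial>lborel)"
      using nn_integral_lborel_translate[of "\<lambda>x. f x * indicator ?Q (x - t) *
          indicator ?Q (x - lattice_point k)" "lattice_point k"] by simp
    also have "\<dots> = (\<integral>\<^sup>+x. f x * indicator ?Q x * indicator ?Q (x - t + lattice_point k) \<partial>lborel)"
      by (simp add: lattice_periodicD[OF per lattice_point_in_int_lattice] algebra_simps)
    finally show "(\<integral>\<^sup>+x. f x * indicator ?Q (x - t) * indicator ?Q (x - lattice_point k) \<partial>lborel)
        = (\<integral>\<^sup>+x. f x * indicator ?Q x * indicator ?Q (x - t + lattice_point k) \<partial>lborel)" .
  qed
  also have "\<dots> = (\<integral>\<^sup>+x. \<integral>\<^sup>+k. f x * indicator ?Q x * indicator ?Q (x - t + lattice_point k) \<partial>?C \<partial>lborel)"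
    by (rule exch[symmetric]) simp
  also have "\<dots> = (\<integral>\<^sup>+x. f x * indicator ?Q x \<partial>lborel)"
    by (simp add: nn_integral_cmult lattice_translates_partition)
  finally show ?thesis .
qed

lemma unit_cube_borel [measurable]: "unit_cube \<in> sets borel"
  by (simp add: unit_cube_def)

lemma AE_unit_cube_iff_half_open_cube:
  "AE x in lborel. x \<in> unit_cube \<longleftrightarrow> x \<in> (half_open_cube :: (real ^ 'd) set)"
proof -
  let ?u = "(\<chi> i. 1) :: real ^ 'd"
  have "cbox 0 ?u - box 0 ?u \<in> null_sets (completion lborel)"
    using negligible_frontier_interval negligible_iff_null_sets by blast
  then have "cbox 0 ?u - box 0 ?u \<in> null_sets lborel"
    by (subst (asm) null_sets_completion_iff) auto
  then have "AE x in lborel. x \<notin> cbox 0 ?u - box 0 ?u"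
    by (rule AE_not_in)
  then show ?thesis
    by eventually_elim
       (auto simp: unit_cube_def half_open_cube_def mem_box_cart intro: less_imp_le)
qed

lemma nn_integral_unit_cube_translate:
  fixes f :: "real ^ 'd \<Rightarrow> ennreal"
  assumes "f \<in> borel_measurable borel" "lattice_periodic f"
  shows "(\<integral>\<^sup>+x. f (x + t) * indicator unit_cube x \<partial>lborel)
       = (\<integral>\<^sup>+x. f x * indicator unit_cube x \<partial>lborel)"
proof -
  have eq: "(\<integral>\<^sup>+x. h x * indicator unit_cube x \<partial>lborel)
      = (\<integral>\<^sup>+x. h x * indicator half_open_cube x \<partial>lborel)" for h :: "real ^ 'd \<Rightarrow> ennreal"
    by (rule nn_integral_cong_AE, use AE_unit_cube_iff_half_open_cube in eventually_elim)
       (simp add: indicator_def)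
  show ?thesis unfolding eq by (rule nn_integral_half_open_cube_translate) fact+
qed

lemma torus_integral_translate:
  fixes f :: "real ^ 'd \<Rightarrow> real"
  assumes f [measurable]: "f \<in> borel_measurable borel" and per: "lattice_periodic f"
    and int: "set_integrable lborel unit_cube f"
  shows "set_integrable lborel unit_cube (\<lambda>x. f (x + t))"
    and "(LINT x:unit_cube|lborel. f (x + t)) = (LINT x:unit_cube|lborel. f x)"
proof -
  have nn: "(\<integral>\<^sup>+x. ennreal (h (f (x + t))) * indicator unit_cube x \<partial>lborel)
      = (\<integral>\<^sup>+x. ennreal (h (f x)) * indicator unit_cube x \<partial>lborel)"
    if [measurable]: "h \<in> borel_measurable borel" for h
    by (rule nn_integral_unit_cube_translate)
       (auto intro: lattice_periodic_compose[OF per, of "\<lambda>y. ennreal (h y)"])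
  have ind: "(\<integral>\<^sup>+x. ennreal (h (indicator unit_cube x *\<^sub>R g x)) \<partial>lborel)
      = (\<integral>\<^sup>+x. ennreal (h (g x)) * indicator unit_cube x \<partial>lborel)"
    if "h 0 = 0" for h :: "real \<Rightarrow> real" and g :: "real ^ 'd \<Rightarrow> real"
    by (rule nn_integral_cong) (use that in \<open>simp add: indicator_def\<close>)
  have same: "(\<integral>\<^sup>+x. ennreal (h (indicator unit_cube x *\<^sub>R f (x + t))) \<partial>lborel)
      = (\<integral>\<^sup>+x. ennreal (h (indicator unit_cube x *\<^sub>R f x)) \<partial>lborel)"
    if "h 0 = 0" "h \<in> borel_measurable borel" for h
    using ind[of h f] ind[of h "\<lambda>x. f (x + t)"] nn[of h] that by simp
  show int': "set_integrable lborel unit_cube (\<lambda>x. f (x + t))"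
    using int same[of norm] unfolding set_integrable_def integrable_iff_bounded by auto
  show "(LINT x:unit_cube|lborel. f (x + t)) = (LINT x:unit_cube|lborel. f x)"
    unfolding set_lebesgue_integral_def
      real_lebesgue_integral_def[OF int[unfolded set_integrable_def]]
      real_lebesgue_integral_def[OF int'[unfolded set_integrable_def]]
    using same[of "\<lambda>y. y"] same[of uminus] by simp
qed

lemma continuous_set_integrable_unit_cube:
  fixes f :: "real ^ 'd \<Rightarrow> real"
  shows "continuous_on UNIV f \<Longrightarrow> set_integrable lborel unit_cube f"
  unfolding set_integrable_def unit_cube_def
  by (intro borel_integrable_compact) (auto intro: continuous_on_subset)

lemma integral_unit_cube_const: "(LINT x:(unit_cube :: (real ^ 'd) set)|lborel. c) = (c :: real)"
proof -
  have "cbox 0 ((\<chi> i. 1) :: real ^ 'd) \<noteq> {}" by (simp add: interval_ne_empty_cart)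
  then have "measure lborel (unit_cube :: (real ^ 'd) set) = 1"
    unfolding unit_cube_def by (subst content_cbox_cart) auto
  moreover have "emeasure lborel (unit_cube :: (real ^ 'd) set) < \<infinity>"
    unfolding unit_cube_def by (rule emeasure_compact_finite) simp
  ultimately show ?thesis
    unfolding set_lebesgue_integral_def by simp
qed

section \<open>Uniform equidistribution\<close>

lemma lattice_periodic_range:
  fixes f :: "real ^ 'd \<Rightarrow> 'a"
  assumes "lattice_periodic f"
  shows "range f = f ` unit_cube"
proof -
  have "f y \<in> f ` unit_cube" for y
  proof -
    obtain m where m: "m \<in> int_lattice" "y - m \<in> unit_cube" using unit_cube_representative .
    have "f y = f (y - m)" using lattice_periodicD[OF assms m(1), of "y - m"] by simp
    then show ?thesis using m(2) by blast
  qed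
  then show ?thesis by blast
qed

lemma continuous_periodic_compact_range:
  fixes f :: "real ^ 'd \<Rightarrow> 'a :: topological_space"
  assumes "continuous_on UNIV f" "lattice_periodic f"
  shows "compact (range f)"
  unfolding lattice_periodic_range[OF assms(2)]
  by (rule compact_continuous_image) (auto simp: unit_cube_def intro: continuous_on_subset[OF assms(1)])

text \<open>
  Two points at distance less than \<open>1\<close> can be moved by one common lattice vector into the compact
  \<open>1\<close>-neighbourhood of the cube, where uniform continuity is automatic.
\<close>

lemma continuous_periodic_uniformly_continuous:
  fixes f :: "real ^ 'd \<Rightarrow> real"
  assumes f: "continuous_on UNIV f" and per: "lattice_periodic f"
  shows "uniformly_continuous_on UNIV f"
  unfolding uniformly_continuous_on_def
proof (intro allI impI)
  fix e :: real assume "0 < e"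
  define A where "A = {x + y | x y. x \<in> (unit_cube :: (real ^ 'd) set) \<and> y \<in> cball 0 1}"
  have "compact A" by (unfold A_def, rule compact_sums) (auto simp: unit_cube_def)
  then have "uniformly_continuous_on A f"
    by (rule compact_uniformly_continuous[OF continuous_on_subset[OF f subset_UNIV]])
  then obtain d where d: "0 < d" "\<And>x y. x \<in> A \<Longrightarrow> y \<in> A \<Longrightarrow> dist y x < d \<Longrightarrow> dist (f y) (f x) < e"
    using \<open>0 < e\<close> unfolding uniformly_continuous_on_def by blast
  have "dist (f y) (f x) < e" if xy: "dist y x < min d 1" for x y
  proof -
    obtain m where m: "m \<in> int_lattice" "x - m \<in> unit_cube" using unit_cube_representative .
    have "y - x \<in> cball 0 1" using xy by (simp add: dist_norm norm_minus_commute)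
    then have yB: "(x - m) + (y - x) \<in> A" using m(2) unfolding A_def by blast
    have "(0 :: real ^ 'd) \<in> cball 0 1" by simp
    then have xB: "(x - m) + 0 \<in> A" using m(2) unfolding A_def by blast
    have eq: "(x - m) + (y - x) = y - m" "(x - m) + 0 = x - m" by simp_all
    have "dist (y - m) (x - m) < d" using xy by (simp add: dist_norm)
    then have "dist (f (y - m)) (f (x - m)) < e"
      by (rule d(2)[OF xB[unfolded eq] yB[unfolded eq]])
    then show ?thesis
      using lattice_periodicD[OF per m(1), of "y - m"] lattice_periodicD[OF per m(1), of "x - m"] by simp
  qed
  then show "\<exists>d>0. \<forall>x\<in>UNIV. \<forall>x'\<in>UNIV. dist x' x < d \<longrightarrow> dist (f x') (f x) < e"
    using d(1) by (intro exI[of _ "min d 1"]) auto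
qed

lemma continuous_periodic_bounded:
  fixes f :: "real ^ 'd \<Rightarrow> 'a :: real_normed_vector"
  assumes "continuous_on UNIV f" "lattice_periodic f"
  obtains B where "0 < B" "\<And>x. norm (f x) \<le> B"
  using compact_imp_bounded[OF continuous_periodic_compact_range[OF assms]]
  unfolding bounded_pos by auto

definition orbit_sum :: "real ^ 'd \<Rightarrow> (real ^ 'd \<Rightarrow> real) \<Rightarrow> nat \<Rightarrow> real ^ 'd \<Rightarrow> real" where
  "orbit_sum \<alpha> f n x = (\<Sum>j<n. f (x + of_nat j *\<^sub>R \<alpha>))"

text \<open>
  Moving the starting point of a Birkhoff sum by one step of the orbit exchanges only one summand.
\<close>

lemma orbit_sum_shift_nat:
  fixes f :: "real ^ 'd \<Rightarrow> real"
  assumes B: "\<And>x. \<bar>f x\<bar> \<le> B"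
  shows "\<bar>orbit_sum \<alpha> f n (x + of_nat k *\<^sub>R \<alpha>) - orbit_sum \<alpha> f n x\<bar> \<le> 2 * of_nat k * B"
proof (induction k)
  case (Suc k)
  have step: "orbit_sum \<alpha> f n (y + \<alpha>) = orbit_sum \<alpha> f n y + f (y + of_nat n *\<^sub>R \<alpha>) - f y" for y
  proof -
    have "orbit_sum \<alpha> f n (y + \<alpha>) + f y = orbit_sum \<alpha> f (Suc n) y"
      unfolding orbit_sum_def by (subst sum.lessThan_Suc_shift) (simp add: algebra_simps)
    then show ?thesis by (simp add: orbit_sum_def)
  qed
  let ?y = "x + of_nat k *\<^sub>R \<alpha>"
  have "x + of_nat (Suc k) *\<^sub>R \<alpha> = ?y + \<alpha>" by (simp add: algebra_simps)
  then show ?case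
    using Suc step[of ?y] B[of ?y] B[of "?y + of_nat n *\<^sub>R \<alpha>"] by (simp add: algebra_simps)
qed simp

lemma orbit_sum_shift_int:
  fixes f :: "real ^ 'd \<Rightarrow> real"
  assumes B: "\<And>x. \<bar>f x\<bar> \<le> B"
  shows "\<bar>orbit_sum \<alpha> f n (x + of_int k *\<^sub>R \<alpha>) - orbit_sum \<alpha> f n x\<bar> \<le> 2 * of_int \<bar>k\<bar> * B"
proof (cases "0 \<le> k")
  case True
  then show ?thesis using orbit_sum_shift_nat[of f B \<alpha> n x "nat k", OF B] by simp
next
  case False
  then show ?thesis
    using orbit_sum_shift_nat[of f B \<alpha> n "x + of_int k *\<^sub>R \<alpha>" "nat (- k)", OF B] by simp
qed

text \<open>
  For any \<open>x\<close> and \<open>y\<close>, some \<open>x + k \<alpha>\<close> with \<open>\<bar>k\<bar> \<le> K\<close> is so close to \<open>y\<close> that corresponding summands differ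
  by at most \<open>\<epsilon> / 2\<close>; passing from \<open>x\<close> to \<open>x + k \<alpha>\<close> costs at most \<open>2 K B\<close>, where \<open>B\<close> bounds \<open>\<bar>f\<bar>\<close>,
  and this is negligible for large \<open>n\<close>.
\<close>

lemma orbit_sum_oscillation:
  fixes f :: "real ^ 'd \<Rightarrow> real"
  assumes ri: "rationally_independent \<alpha>"
    and f: "continuous_on UNIV f" "lattice_periodic f" and \<epsilon>: "0 < \<epsilon>"
  obtains N where "\<And>n x y. N \<le> n \<Longrightarrow> \<bar>orbit_sum \<alpha> f n x - orbit_sum \<alpha> f n y\<bar> \<le> \<epsilon> * of_nat n"
proof -
  obtain B where B: "0 < B" "\<And>x. \<bar>f x\<bar> \<le> B"
    using continuous_periodic_bounded[OF f] by auto
  obtain d where d: "0 < d" "\<And>x y. dist x y < d \<Longrightarrow> dist (f x) (f y) < \<epsilon> / 2"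
    using continuous_periodic_uniformly_continuous[OF f] half_gt_zero[OF \<epsilon>]
    unfolding uniformly_continuous_on_def by (metis UNIV_I)
  obtain K where K: "\<And>y. \<exists>(k::int) m. \<bar>k\<bar> \<le> int K \<and> m \<in> int_lattice \<and>
      dist (of_int k *\<^sub>R \<alpha> + m) y < d"
    using orbit_uniformly_dense[OF ri d(1)] by blast
  define N where "N = nat \<lceil>4 * real K * B / \<epsilon>\<rceil>"
  have "\<bar>orbit_sum \<alpha> f n x - orbit_sum \<alpha> f n y\<bar> \<le> \<epsilon> * of_nat n" if n: "N \<le> n" for n x y
  proof -
    obtain k m where k: "\<bar>k\<bar> \<le> int K" "m \<in> int_lattice" "dist (of_int k *\<^sub>R \<alpha> + m) (y - x) < d"
      using K by blast
    let ?x = "x + of_int k *\<^sub>R \<alpha>"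
    have close: "\<bar>f (?x + of_nat j *\<^sub>R \<alpha>) - f (y + of_nat j *\<^sub>R \<alpha>)\<bar> \<le> \<epsilon> / 2" for j
    proof -
      have "dist (?x + of_nat j *\<^sub>R \<alpha> + m) (y + of_nat j *\<^sub>R \<alpha>) < d"
        using k(3) by (simp add: dist_norm algebra_simps)
      from d(2)[OF this] show ?thesis
        using lattice_periodicD[OF f(2) k(2), of "?x + of_nat j *\<^sub>R \<alpha>"] by (simp add: dist_real_def)
    qed
    have "\<bar>orbit_sum \<alpha> f n ?x - orbit_sum \<alpha> f n y\<bar>
        \<le> (\<Sum>j<n. \<bar>f (?x + of_nat j *\<^sub>R \<alpha>) - f (y + of_nat j *\<^sub>R \<alpha>)\<bar>)"
      unfolding orbit_sum_def sum_subtractf[symmetric] by (rule sum_abs)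
    also have "\<dots> \<le> (\<Sum>j<n. \<epsilon> / 2)" by (intro sum_mono close)
    finally have "\<bar>orbit_sum \<alpha> f n ?x - orbit_sum \<alpha> f n y\<bar> \<le> \<epsilon> / 2 * of_nat n" by (simp add: mult.commute)
    moreover have "\<bar>orbit_sum \<alpha> f n ?x - orbit_sum \<alpha> f n x\<bar> \<le> 2 * real K * B"
    proof -
      have "2 * of_int \<bar>k\<bar> * B \<le> 2 * real K * B"
        using k(1) B(1) by (intro mult_right_mono mult_left_mono) auto
      then show ?thesis using orbit_sum_shift_int[of f B \<alpha> n x k, OF B(2)] by linarith
    qed
    moreover have "2 * real K * B \<le> \<epsilon> / 2 * of_nat n"
    proof -
      have "4 * real K * B / \<epsilon> \<le> of_nat n" using n unfolding N_def by linarith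
      then show ?thesis using \<epsilon> by (simp add: field_simps)
    qed
    ultimately show ?thesis by argo
  qed
  then show ?thesis using that by blast
qed

lemma continuous_orbit_sum:
  assumes "continuous_on UNIV f"
  shows "continuous_on UNIV (orbit_sum \<alpha> f n)"
  unfolding orbit_sum_def[abs_def]
  by (intro continuous_on_sum continuous_on_compose2[OF assms] continuous_intros) auto

lemma integral_orbit_sum:
  fixes f :: "real ^ 'd \<Rightarrow> real"
  assumes [measurable]: "f \<in> borel_measurable borel" and "lattice_periodic f"
    and "set_integrable lborel unit_cube f"
  shows "set_integrable lborel unit_cube (orbit_sum \<alpha> f n)"
    and "(LINT x:unit_cube|lborel. orbit_sum \<alpha> f n x) = of_nat n * (LINT x:unit_cube|lborel. f x)"
proof -
  note tr = torus_integral_translate[OF assms, unfolded set_integrable_def set_lebesgue_integral_def]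
  show "set_integrable lborel unit_cube (orbit_sum \<alpha> f n)"
    unfolding orbit_sum_def[abs_def] set_integrable_def scaleR_sum_right
    by (intro Bochner_Integration.integrable_sum tr(1))
  show "(LINT x:unit_cube|lborel. orbit_sum \<alpha> f n x) = of_nat n * (LINT x:unit_cube|lborel. f x)"
    unfolding orbit_sum_def set_lebesgue_integral_def scaleR_sum_right
    by (subst Bochner_Integration.integral_sum[OF tr(1)]) (simp only: tr(2) sum_constant card_lessThan)
qed

text \<open>
  The Birkhoff sums are nearly constant in \<open>x\<close> and, by translation invariance, their mean over the
  torus is \<open>n\<close> times the integral of \<open>f\<close>. This is the upper half of uniform equidistribution.
\<close>

lemma Weyl_uniform_upper:
  fixes f :: "real ^ 'd \<Rightarrow> real"
  assumes ri: "rationally_independent \<alpha>"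
    and f: "continuous_on UNIV f" "lattice_periodic f" and s: "(LINT x:unit_cube|lborel. f x) < s"
  obtains N where "\<And>n x. N \<le> n \<Longrightarrow> orbit_sum \<alpha> f n x \<le> s * of_nat n"
proof -
  let ?I = "LINT x:unit_cube|lborel. f x"
  obtain N where N: "\<And>n x y. N \<le> n \<Longrightarrow>
      \<bar>orbit_sum \<alpha> f n x - orbit_sum \<alpha> f n y\<bar> \<le> (s - ?I) * of_nat n"
    using orbit_sum_oscillation[OF ri f, of "s - ?I"] s by auto
  have "orbit_sum \<alpha> f n x \<le> s * of_nat n" if n: "N \<le> n" for n x
  proof -
    have int: "set_integrable lborel unit_cube f" and [measurable]: "f \<in> borel_measurable borel"
      using f(1) by (auto intro: continuous_set_integrable_unit_cube borel_measurable_continuous_onI)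
    have "orbit_sum \<alpha> f n x - (s - ?I) * of_nat n
        = (LINT y:(unit_cube::(real ^ 'd) set)|lborel. orbit_sum \<alpha> f n x - (s - ?I) * of_nat n)"
      by (simp add: integral_unit_cube_const)
    also have "\<dots> \<le> (LINT y:unit_cube|lborel. orbit_sum \<alpha> f n y)"
    proof (rule set_integral_mono)
      show "orbit_sum \<alpha> f n x - (s - ?I) * of_nat n \<le> orbit_sum \<alpha> f n y" for y
        using N[OF n, of x y] by linarith
    qed (auto intro!: continuous_set_integrable_unit_cube continuous_orbit_sum f(1))
    also have "\<dots> = of_nat n * ?I" by (rule integral_orbit_sum(2)[OF _ f(2) int]) measurable
    finally show ?thesis by (simp add: algebra_simps)
  qed
  then show ?thesis using that by blast
qed

text \<open>
  Exponentiated equidistribution; the constant \<open>C\<close> absorbs the short products.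
\<close>

lemma orbit_prod_exp_bound:
  fixes g :: "real ^ 'd \<Rightarrow> real"
  assumes ri: "rationally_independent \<alpha>"
    and g: "continuous_on UNIV g" "lattice_periodic g" "\<And>x. 0 < g x"
    and s: "(LINT x:unit_cube|lborel. ln (g x)) < s"
  obtains C where "0 < C" "\<And>n x. (\<Prod>j<n. g (x + of_nat j *\<^sub>R \<alpha>)) \<le> C * exp s ^ n"
proof -
  have lg: "continuous_on UNIV (\<lambda>x. ln (g x))" "lattice_periodic (\<lambda>x. ln (g x))"
    using g(3) by (auto intro!: continuous_on_ln g(1) lattice_periodic_compose[OF g(2)] simp: less_imp_neq[symmetric])
  obtain N where N: "\<And>n x. N \<le> n \<Longrightarrow> orbit_sum \<alpha> (\<lambda>x. ln (g x)) n x \<le> s * of_nat n"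
    using Weyl_uniform_upper[OF ri lg s] by blast
  obtain B where B: "0 < B" "\<And>x. \<bar>g x\<bar> \<le> B"
    using continuous_periodic_bounded[OF g(1,2)] by auto
  define C where "C = max 1 (Max ((\<lambda>n. B ^ n / exp s ^ n) ` {..N}))"
  have "(\<Prod>j<n. g (x + of_nat j *\<^sub>R \<alpha>)) \<le> C * exp s ^ n" for n x
  proof (cases "N \<le> n")
    case True
    have "(\<Prod>j<n. g (x + of_nat j *\<^sub>R \<alpha>)) = exp (orbit_sum \<alpha> (\<lambda>x. ln (g x)) n x)"
      unfolding orbit_sum_def by (simp add: exp_sum g(3))
    also have "\<dots> \<le> exp (s * of_nat n)" using N[OF True] by simp
    also have "\<dots> = exp s ^ n" by (simp add: exp_of_nat2_mult)
    also have "\<dots> \<le> C * exp s ^ n" by (simp add: C_def)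
    finally show ?thesis .
  next
    case False
    have "(\<Prod>j<n. g (x + of_nat j *\<^sub>R \<alpha>)) \<le> (\<Prod>j<n. B)"
      using g(3) B(2) by (intro prod_mono) (auto intro: less_imp_le order_trans[OF abs_ge_self])
    also have "\<dots> = B ^ n / exp s ^ n * exp s ^ n" by simp
    also have "B ^ n / exp s ^ n \<le> Max ((\<lambda>n. B ^ n / exp s ^ n) ` {..N})"
      using False by (intro Max_ge) auto
    also have "\<dots> \<le> C" by (simp add: C_def)
    finally show ?thesis by (simp add: mult_right_mono)
  qed
  moreover have "0 < C" by (simp add: C_def)
  ultimately show ?thesis using that by blast
qed

text \<open>
  Bounds on forward products that are uniform in the starting point carry over to backward products:
  read the orbit segment from its other end.
\<close>

lemma prod_reverse_orbit:
  fixes g :: "real ^ 'd \<Rightarrow> 'a :: comm_monoid_mult"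
  shows "(\<Prod>j<n. g (x - of_nat j *\<^sub>R \<alpha>)) = (\<Prod>j<n. g (x - (of_nat n - 1) *\<^sub>R \<alpha> + of_nat j *\<^sub>R \<alpha>))"
proof -
  let ?h = "\<lambda>j. g (x - (of_nat n - 1) *\<^sub>R \<alpha> + of_nat j *\<^sub>R \<alpha>)"
  have "prod ?h {..<n} = (\<Prod>j<n. ?h (n - Suc j))" by (rule prod.nat_diff_reindex[symmetric])
  also have "\<dots> = (\<Prod>j<n. g (x - of_nat j *\<^sub>R \<alpha>))"
  proof (rule prod.cong[OF refl])
    fix j assume "j \<in> {..<n}"
    then have "real (n - Suc j) = of_nat n - 1 - of_nat j" by (simp add: of_nat_diff)
    then have "x - (of_nat n - 1) *\<^sub>R \<alpha> + of_nat (n - Suc j) *\<^sub>R \<alpha> = x - of_nat j *\<^sub>R \<alpha>"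
      by (simp only:) (simp add: algebra_simps)
    then show "?h (n - Suc j) = g (x - of_nat j *\<^sub>R \<alpha>)" by (simp only:)
  qed
  finally show ?thesis by simp
qed

section \<open>Square-summable sequences and resolvents\<close>

lemma ell2_L2_set_le:
  assumes "u \<in> ell2"
  shows "L2_set (\<lambda>n. cmod (u n)) F \<le> ell2_norm u"
proof (cases "finite F")
  case True
  then show ?thesis
    unfolding L2_set_def ell2_norm_def using assms
    by (intro real_sqrt_le_mono finite_sum_le_infsum) (auto simp: ell2_def)
qed (use assms in \<open>simp add: ell2_norm_def infsum_nonneg\<close>)

lemma ell2_norm_nonneg: "0 \<le> ell2_norm u"
  by (simp add: ell2_norm_def infsum_nonneg)

text \<open>
  Finite sections control membership and norm at once, so that all norm estimates below are estimates
  of finite sums.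
\<close>

lemma ell2I:
  assumes le: "\<And>F. finite F \<Longrightarrow> L2_set (\<lambda>n. cmod (u n)) F \<le> K"
  shows "u \<in> ell2" and "ell2_norm u \<le> K"
proof -
  have K: "0 \<le> K" using le[of "{}"] by simp
  have sq: "(\<Sum>n\<in>F. (cmod (u n))\<^sup>2) \<le> K\<^sup>2" if "finite F" for F
    using le[OF that] K unfolding L2_set_def by (simp add: real_sqrt_le_iff' real_le_lsqrt sqrt_le_D)
  show u: "u \<in> ell2"
    unfolding ell2_def mem_Collect_eq
    by (rule nonneg_bdd_above_summable_on) (auto intro!: bdd_aboveI[of _ "K\<^sup>2"] sq)
  have "(\<Sum>\<^sub>\<infinity>n. (cmod (u n))\<^sup>2) \<le> K\<^sup>2"
    using u by (intro infsum_le_finite_sums sq) (auto simp: ell2_def)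
  then show "ell2_norm u \<le> K"
    unfolding ell2_norm_def using K by (intro real_le_lsqrt) (auto intro: infsum_nonneg)
qed

lemma cmod_le_ell2_norm: "u \<in> ell2 \<Longrightarrow> cmod (u n) \<le> ell2_norm u"
  using ell2_L2_set_le[of u "{n}"] by simp

lemma ell2_diff:
  assumes "u \<in> ell2" "v \<in> ell2"
  shows "(\<lambda>n. u n - v n) \<in> ell2"
proof (rule ell2I(1))
  fix F :: "int set" assume F: "finite F"
  have "L2_set (\<lambda>n. cmod (u n - v n)) F \<le> L2_set (\<lambda>n. cmod (u n) + cmod (v n)) F"
    by (intro L2_set_mono norm_triangle_ineq4) auto
  also have "\<dots> \<le> L2_set (\<lambda>n. cmod (u n)) F + L2_set (\<lambda>n. cmod (v n)) F"
    by (rule L2_set_triangle_ineq)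
  also have "\<dots> \<le> ell2_norm u + ell2_norm v"
    using assms by (intro add_mono ell2_L2_set_le)
  finally show "L2_set (\<lambda>n. cmod (u n - v n)) F \<le> ell2_norm u + ell2_norm v" .
qed

lemma ell2_scale:
  assumes "u \<in> ell2"
  shows "(\<lambda>n. c * u n) \<in> ell2"
proof (rule ell2I(1))
  fix F :: "int set" assume F: "finite F"
  show "L2_set (\<lambda>n. cmod (c * u n)) F \<le> cmod c * ell2_norm u"
    using ell2_L2_set_le[OF assms, of F]
    by (simp add: norm_mult L2_set_right_distrib[symmetric] mult_left_mono)
qed

lemma ell2_add: "u \<in> ell2 \<Longrightarrow> v \<in> ell2 \<Longrightarrow> (\<lambda>n. u n + v n) \<in> ell2"
  using ell2_diff[of u "\<lambda>n. - 1 * v n"] ell2_scale[of v "-1"] by simp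

lemma ell2_dominated:
  assumes v: "v \<in> ell2" and le: "\<And>n. cmod (u n) \<le> c * cmod (v n)" and c: "0 \<le> c"
  shows "u \<in> ell2" and "ell2_norm u \<le> c * ell2_norm v"
proof -
  have "L2_set (\<lambda>n. cmod (u n)) F \<le> c * ell2_norm v" for F
  proof -
    have "L2_set (\<lambda>n. cmod (u n)) F \<le> L2_set (\<lambda>n. c * cmod (v n)) F"
      by (intro L2_set_mono le) auto
    also have "\<dots> \<le> c * ell2_norm v"
      using ell2_L2_set_le[OF v, of F] c by (simp add: L2_set_right_distrib[symmetric] mult_left_mono)
    finally show ?thesis .
  qed
  then show "u \<in> ell2" "ell2_norm u \<le> c * ell2_norm v" using ell2I by blast+
qed

lemma ell2_shift:
  assumes "u \<in> ell2"
  shows "(\<lambda>n. u (n + k)) \<in> ell2" and "ell2_norm (\<lambda>n. u (n + k)) \<le> ell2_norm u"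
proof -
  have "L2_set (\<lambda>n. cmod (u (n + k))) F \<le> ell2_norm u" for F
  proof -
    have "L2_set (\<lambda>n. cmod (u (n + k))) F = L2_set (\<lambda>n. cmod (u n)) ((\<lambda>n. n + k) ` F)"
      by (simp add: L2_set_def sum.reindex)
    then show ?thesis using ell2_L2_set_le[OF assms] by simp
  qed
  then show "(\<lambda>n. u (n + k)) \<in> ell2" "ell2_norm (\<lambda>n. u (n + k)) \<le> ell2_norm u"
    using ell2I[of "\<lambda>n. u (n + k)"] by blast+
qed

definition unit_seq :: "int \<Rightarrow> int \<Rightarrow> complex" where
  "unit_seq k n = (if n = k then 1 else 0)"

lemma unit_seq_ell2: "unit_seq k \<in> ell2" and ell2_norm_unit_seq: "ell2_norm (unit_seq k) = 1"
proof -
  have le: "L2_set (\<lambda>n. cmod (unit_seq k n)) F \<le> 1" if "finite F" for F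
  proof -
    have "(\<Sum>n\<in>F. (cmod (unit_seq k n))\<^sup>2) = (\<Sum>n\<in>F. if n = k then 1 else 0)"
      by (rule sum.cong) (auto simp: unit_seq_def)
    then show ?thesis using that by (simp add: L2_set_def)
  qed
  show u: "unit_seq k \<in> ell2" by (rule ell2I(1)[OF le])
  show "ell2_norm (unit_seq k) = 1"
  proof (rule antisym)
    show "ell2_norm (unit_seq k) \<le> 1" by (rule ell2I(2)[OF le])
    show "1 \<le> ell2_norm (unit_seq k)"
      using cmod_le_ell2_norm[OF u, of k] by (simp add: unit_seq_def)
  qed
qed

text \<open>
  Linearity on all sequences, not only on the square-summable ones, frees the criterion for resolvent
  points from any domain condition on the operator.
\<close>

definition linear_on_sequences :: "((int \<Rightarrow> complex) \<Rightarrow> (int \<Rightarrow> complex)) \<Rightarrow> bool" where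
  "linear_on_sequences T \<longleftrightarrow>
     (\<forall>u v. T (\<lambda>n. u n + v n) = (\<lambda>n. T u n + T v n)) \<and> (\<forall>c u. T (\<lambda>n. c * u n) = (\<lambda>n. c * T u n))"

text \<open>
  Unique solvability with a norm bound suffices: the solution operator is then single-valued, hence
  linear, and it is the bounded inverse.
\<close>

lemma resolvent_setI:
  assumes T: "linear_on_sequences T"
    and onto: "\<And>f. f \<in> ell2 \<Longrightarrow> \<exists>u\<in>ell2. (\<forall>n. T u n - z * u n = f n) \<and> ell2_norm u \<le> K * ell2_norm f"
    and kernel: "\<And>u n. u \<in> ell2 \<Longrightarrow> (\<And>n. T u n = z * u n) \<Longrightarrow> u n = 0"
  shows "z \<in> resolvent_set T"
proof -
  define B where "B u = (\<lambda>n. T u n - z * u n)" for u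
  have T_add: "T (\<lambda>n. u n + v n) = (\<lambda>n. T u n + T v n)" and T_scale: "T (\<lambda>n. c * u n) = (\<lambda>n. c * T u n)"
    for u v c using T by (auto simp: linear_on_sequences_def)
  have B_add: "B (\<lambda>n. u n + v n) = (\<lambda>n. B u n + B v n)" and B_scale: "B (\<lambda>n. c * u n) = (\<lambda>n. c * B u n)"
    for u v c by (simp_all add: B_def T_add T_scale algebra_simps)
  have inj: "u = v" if "u \<in> ell2" "v \<in> ell2" "B u = B v" for u v
  proof -
    define d where "d n = u n + -1 * v n" for n
    have d: "d \<in> ell2" unfolding d_def using ell2_diff[OF that(1,2)] by simp
    have "B d = (\<lambda>_. 0)"
      unfolding d_def B_add B_scale using that(3) by simp
    then have "T d n = z * d n" for n
      by (simp add: B_def fun_eq_iff)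
    then have "d n = 0" for n by (rule kernel[OF d])
    then show "u = v" by (simp add: fun_eq_iff d_def)
  qed
  define R where "R f = (THE u. u \<in> ell2 \<and> B u = f)" for f
  have R_eq: "R f = u" if "u \<in> ell2" "B u = f" for u f
    unfolding R_def using that inj by (intro the_equality) auto
  have R: "R f \<in> ell2" "B (R f) = f" "ell2_norm (R f) \<le> K * ell2_norm f" if f: "f \<in> ell2" for f
  proof -
    obtain u where u: "u \<in> ell2" "B u = f" "ell2_norm u \<le> K * ell2_norm f"
      using onto[OF f] unfolding B_def by blast
    then show "R f \<in> ell2" "B (R f) = f" "ell2_norm (R f) \<le> K * ell2_norm f" using R_eq[OF u(1,2)] by auto
  qed
  have "bounded_operator R"
    unfolding bounded_operator_def
  proof (intro conjI ballI allI exI[of _ K])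
    fix u assume u: "u \<in> ell2"
    show "R u \<in> ell2" by (rule R(1)[OF u])
    show "ell2_norm (R u) \<le> K * ell2_norm u" by (rule R(3)[OF u])
    show "R (\<lambda>n. c * u n) = (\<lambda>n. c * R u n)" for c
      using R[OF u] by (intro R_eq) (auto simp: B_scale intro: ell2_scale)
    show "R (\<lambda>n. u n + v n) = (\<lambda>n. R u n + R v n)" if "v \<in> ell2" for v
      using R[OF u] R[OF that] by (intro R_eq) (auto simp: B_add intro: ell2_add)
  qed
  moreover have "\<forall>u\<in>ell2. R (B u) = u \<and> B (R u) = u" using R_eq R by auto
  ultimately show ?thesis unfolding resolvent_set_def B_def by blast
qed

lemma resolvent_setE:
  assumes "z \<in> resolvent_set T"
  obtains K where "0 \<le> K"
    "\<And>f. f \<in> ell2 \<Longrightarrow> \<exists>u\<in>ell2. (\<lambda>n. T u n - z * u n) = f \<and> ell2_norm u \<le> K * ell2_norm f"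
    "\<And>u. u \<in> ell2 \<Longrightarrow> (\<lambda>n. T u n - z * u n) \<in> ell2 \<Longrightarrow>
      ell2_norm u \<le> K * ell2_norm (\<lambda>n. T u n - z * u n)"
proof -
  obtain R where R: "bounded_operator R"
    "\<And>u. u \<in> ell2 \<Longrightarrow> R (\<lambda>n. T u n - z * u n) = u \<and> (\<lambda>n. T (R u) n - z * R u n) = u"
    using assms unfolding resolvent_set_def by blast
  obtain K0 where K0: "\<And>u. u \<in> ell2 \<Longrightarrow> ell2_norm (R u) \<le> K0 * ell2_norm u"
    using R(1) unfolding bounded_operator_def by blast
  have K: "ell2_norm (R u) \<le> max K0 0 * ell2_norm u" if "u \<in> ell2" for u
    using K0[OF that] mult_right_mono[OF max.cobounded1[of K0 0] ell2_norm_nonneg[of u]] by linarith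
  show thesis
  proof (rule that[of "max K0 0"])
    fix f assume f: "f \<in> ell2"
    then show "\<exists>u\<in>ell2. (\<lambda>n. T u n - z * u n) = f \<and> ell2_norm u \<le> max K0 0 * ell2_norm f"
      using R K[OF f] unfolding bounded_operator_def by blast
  next
    fix u assume "u \<in> ell2" "(\<lambda>n. T u n - z * u n) \<in> ell2"
    then show "ell2_norm u \<le> max K0 0 * ell2_norm (\<lambda>n. T u n - z * u n)"
      using R(2) K by metis
  qed simp
qed

section \<open>Contracting weighted shifts\<close>

text \<open>
  Iterating the equation gives the Neumann series \<open>u n = (\<Sum>m. w n * \<dots> * w (n + (m - 1) s) * g (n + m s))\<close>.
  Its \<open>m\<close>-th term is a shift of \<open>g\<close> times weights bounded by \<open>C q\<^sup>m\<close>, so that the norms of the terms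
  sum to at most \<open>C / (1 - q)\<close> times the norm of \<open>g\<close>.
\<close>

lemma weighted_shift_solution:
  fixes w :: "int \<Rightarrow> complex" and s :: int
  assumes prod: "\<And>n m. cmod (\<Prod>j<m. w (n + int j * s)) \<le> C * q ^ m"
    and q: "0 \<le> q" "q < 1" and g: "g \<in> ell2"
  obtains u where "u \<in> ell2" "ell2_norm u \<le> C / (1 - q) * ell2_norm g" "\<And>n. u n = g n + w n * u (n + s)"
proof -
  define a where "a n m = (\<Prod>j<m. w (n + int j * s))" for n m
  have a_0: "a n 0 = 1" and a_Suc: "a n (Suc m) = w n * a (n + s) m" for n m
    unfolding a_def by (simp, subst prod.lessThan_Suc_shift) (simp add: algebra_simps)
  have C: "0 \<le> C" using prod[of 0 0] by simp
  have bound: "cmod (a n m * g (n + int m * s)) \<le> C * q ^ m * cmod (g (n + int m * s))" for n m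
    unfolding norm_mult a_def by (intro mult_right_mono prod) auto
  have summ: "summable (\<lambda>m. a n m * g (n + int m * s))" for n
  proof (rule summable_comparison_test')
    show "summable (\<lambda>m. C * ell2_norm g * q ^ m)" using q by (intro summable_mult summable_geometric) auto
    show "norm (a n m * g (n + int m * s)) \<le> C * ell2_norm g * q ^ m" if "0 \<le> m" for m
    proof -
      have "C * q ^ m * cmod (g (n + int m * s)) \<le> C * q ^ m * ell2_norm g"
        using C q(1) by (intro mult_left_mono cmod_le_ell2_norm g) auto
      then show ?thesis using bound[of n m] by (simp add: mult_ac)
    qed
  qed
  define u where "u n = (\<Sum>m. a n m * g (n + int m * s))" for n
  have "u n = g n + w n * u (n + s)" for n
  proof -
    have "u n = a n 0 * g (n + int 0 * s) + (\<Sum>m. a n (Suc m) * g (n + int (Suc m) * s))"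
      using suminf_split_head[OF summ] unfolding u_def by simp
    also have "(\<lambda>m. a n (Suc m) * g (n + int (Suc m) * s)) = (\<lambda>m. w n * (a (n + s) m * g (n + s + int m * s)))"
      by (simp add: a_Suc algebra_simps)
    also have "(\<Sum>m. w n * (a (n + s) m * g (n + s + int m * s))) = w n * u (n + s)"
      unfolding u_def by (rule suminf_mult[OF summ])
    finally show ?thesis by (simp add: a_0)
  qed
  moreover have "L2_set (\<lambda>n. cmod (u n)) F \<le> C / (1 - q) * ell2_norm g" for F
  proof -
    have part: "L2_set (\<lambda>n. cmod (\<Sum>m<M. a n m * g (n + int m * s))) F \<le> (\<Sum>m<M. C * q ^ m * ell2_norm g)" for M
    proof (induction M)
      case (Suc M)
      have "L2_set (\<lambda>n. cmod (a n M * g (n + int M * s))) F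
          \<le> L2_set (\<lambda>n. C * q ^ M * cmod (g (n + int M * s))) F"
        by (intro L2_set_mono bound) auto
      also have "\<dots> = C * q ^ M * L2_set (\<lambda>n. cmod (g (n + int M * s))) F"
        using C q(1) by (simp add: L2_set_right_distrib)
      also have "\<dots> \<le> C * q ^ M * ell2_norm g"
        using C q(1) ell2_L2_set_le[OF ell2_shift(1)[OF g, of "int M * s"], of F] ell2_shift(2)[OF g, of "int M * s"]
        by (intro mult_left_mono) auto
      finally have "L2_set (\<lambda>n. cmod (a n M * g (n + int M * s))) F \<le> C * q ^ M * ell2_norm g" .
      moreover have "L2_set (\<lambda>n. cmod (\<Sum>m<Suc M. a n m * g (n + int m * s))) F
          \<le> L2_set (\<lambda>n. cmod (\<Sum>m<M. a n m * g (n + int m * s)) + cmod (a n M * g (n + int M * s))) F"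
        by (intro L2_set_mono) (auto intro: norm_triangle_ineq)
      ultimately show ?case
        using Suc L2_set_triangle_ineq[of "\<lambda>n. cmod (\<Sum>m<M. a n m * g (n + int m * s))"
            "\<lambda>n. cmod (a n M * g (n + int M * s))" F] by simp
    qed (simp add: L2_set_0')
    have tot: "(\<Sum>m<M. C * q ^ m * ell2_norm g) \<le> C / (1 - q) * ell2_norm g" for M
    proof -
      have "(\<Sum>m<M. q ^ m) \<le> 1 / (1 - q)"
        using q by (simp add: sum_gp_strict divide_right_mono)
      then have "C * (\<Sum>m<M. q ^ m) * ell2_norm g \<le> C * (1 / (1 - q)) * ell2_norm g"
        using C by (intro mult_right_mono mult_left_mono ell2_norm_nonneg)
      then show ?thesis by (simp add: sum_distrib_left sum_distrib_right)
    qed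
    have "(\<lambda>M. L2_set (\<lambda>n. cmod (\<Sum>m<M. a n m * g (n + int m * s))) F) \<longlonglongrightarrow> L2_set (\<lambda>n. cmod (u n)) F"
      unfolding L2_set_def u_def
      by (intro tendsto_intros summable_LIMSEQ summ)
    then show ?thesis
      by (rule LIMSEQ_le_const2) (use order_trans[OF part tot] in blast)
  qed
  ultimately show ?thesis using that ell2I by blast
qed

text \<open>
  Iterating the homogeneous equation expresses \<open>u n\<close> by far-away values of \<open>u\<close>, which are bounded, times
  arbitrarily small products.
\<close>

lemma weighted_shift_kernel:
  fixes w :: "int \<Rightarrow> complex" and s :: int
  assumes prod: "\<And>n m. cmod (\<Prod>j<m. w (n + int j * s)) \<le> C * q ^ m"
    and q: "0 \<le> q" "q < 1" and u: "u \<in> ell2" and eq: "\<And>n. u n = w n * u (n + s)"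
  shows "u n = 0"
proof -
  have iter: "u n = (\<Prod>j<m. w (n + int j * s)) * u (n + int m * s)" for m
  proof (induction m)
    case (Suc m)
    have eq': "n + int (Suc m) * s = n + int m * s + s" by (simp add: algebra_simps)
    show ?case unfolding eq' by (subst Suc, subst eq) simp
  qed simp
  have "0 \<le> C" using prod[of 0 0] by simp
  have "cmod (u n) \<le> C * q ^ m * ell2_norm u" for m
    using mult_mono[OF prod[of n m] cmod_le_ell2_norm[OF u, of "n + int m * s"]] \<open>0 \<le> C\<close> q(1)
    by (subst iter[of m]) (simp add: norm_mult)
  moreover have "(\<lambda>m. C * q ^ m * ell2_norm u) \<longlonglongrightarrow> C * 0 * ell2_norm u"
    using q by (intro tendsto_intros LIMSEQ_realpow_zero) auto
  ultimately have "cmod (u n) \<le> C * 0 * ell2_norm u"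
    by (intro LIMSEQ_le_const[of _ _ "cmod (u n)"]) auto
  then show ?thesis by simp
qed

lemma sum_geometric_int_le:
  fixes q :: real
  assumes q: "0 \<le> q" "q < 1" and F: "finite F"
  shows "(\<Sum>n\<in>F. q ^ nat \<bar>n\<bar>) \<le> 2 / (1 - q)"
proof -
  define N where "N = nat (\<Sum>n\<in>F. \<bar>n\<bar>)"
  have "F \<subseteq> {- int N..int N}"
  proof
    fix n assume n: "n \<in> F"
    have "\<bar>n\<bar> \<le> (\<Sum>n\<in>F. \<bar>n\<bar>)" using n F by (intro member_le_sum) auto
    then show "n \<in> {- int N..int N}" by (auto simp: N_def)
  qed
  then have "(\<Sum>n\<in>F. q ^ nat \<bar>n\<bar>) \<le> (\<Sum>n\<in>{- int N..int N}. q ^ nat \<bar>n\<bar>)"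
    using q by (intro sum_mono2) auto
  also have "\<dots> \<le> 2 * (\<Sum>m<Suc N. q ^ m)"
  proof (induction N)
    case (Suc N)
    have "{- int (Suc N)..int (Suc N)} = {- int N..int N} \<union> {int N + 1, - int N - 1}" by auto
    then have "(\<Sum>n\<in>{- int (Suc N)..int (Suc N)}. q ^ nat \<bar>n\<bar>)
        = (\<Sum>n\<in>{- int N..int N}. q ^ nat \<bar>n\<bar>) + (\<Sum>n\<in>{int N + 1, - int N - 1}. q ^ nat \<bar>n\<bar>)"
      by (simp only:) (intro sum.union_disjoint, auto)
    also have "(\<Sum>n\<in>{int N + 1, - int N - 1}. q ^ nat \<bar>n\<bar>) = 2 * q ^ Suc N"
      by (simp add: nat_add_distrib)
    finally show ?case using Suc by simp
  qed simp
  also have "\<dots> \<le> 2 / (1 - q)"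
    using q by (simp only: sum_gp_strict) (simp add: divide_right_mono)
  finally show ?thesis .
qed

lemma ell2_geometric_decay:
  assumes q: "0 \<le> q" "q < 1" and u: "\<And>n. cmod (u n) \<le> C * q ^ nat \<bar>n\<bar>"
  shows "u \<in> ell2"
proof (rule ell2I(1))
  fix F :: "int set" assume F: "finite F"
  have C: "0 \<le> C" using order_trans[OF norm_ge_zero u[of 0]] by simp
  have "L2_set (\<lambda>n. cmod (u n)) F \<le> (\<Sum>n\<in>F. cmod (u n))" by (rule L2_set_le_sum) simp
  also have "\<dots> \<le> (\<Sum>n\<in>F. C * q ^ nat \<bar>n\<bar>)" by (rule sum_mono[OF u])
  also have "\<dots> \<le> C * (2 / (1 - q))"
    unfolding sum_distrib_left[symmetric] by (intro mult_left_mono sum_geometric_int_le q F C)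
  finally show "L2_set (\<lambda>n. cmod (u n)) F \<le> C * (2 / (1 - q))" .
qed

lemma linear_on_sequences_H_op: "linear_on_sequences (H_op V \<alpha> l \<theta>)"
  by (simp add: linear_on_sequences_def H_op_def algebra_simps fun_eq_iff)

text \<open>
  Solving \<open>(H - z) u = f\<close> for the term with the shift gives
  \<open>u n = f (n + 1) / l + A (\<theta> + (n + 1) \<alpha>) * u (n + 1)\<close> with \<open>A = (z - V) / l\<close>. As only \<open>l\<close> is divided
  by, zeros of \<open>A\<close> do no harm.
\<close>

lemma resolvent_of_forward_contraction:
  assumes l: "l \<noteq> 0" and q: "0 \<le> q" "q < 1"
    and prod: "\<And>x m. (\<Prod>j<m. cmod ((z - V (x + of_nat j *\<^sub>R \<alpha>)) / l)) \<le> C * q ^ m"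
  shows "z \<in> resolvent_set (H_op V \<alpha> l \<theta>)"
proof -
  define w where "w n = (z - V (\<theta> + of_int (n + 1) *\<^sub>R \<alpha>)) / l" for n :: int
  have w: "cmod (\<Prod>j<m. w (n + int j * 1)) \<le> C * q ^ m" for n m
    using prod[where x = "\<theta> + of_int (n + 1) *\<^sub>R \<alpha>" and m = m]
    by (simp add: w_def prod_norm[symmetric] algebra_simps)
  have eq: "(\<forall>n. H_op V \<alpha> l \<theta> u n - z * u n = f n) \<longleftrightarrow> (\<forall>n. u n = f (n + 1) / l + w n * u (n + 1))"
    for u f
  proof -
    have "H_op V \<alpha> l \<theta> u (n + 1) - z * u (n + 1) = f (n + 1) \<longleftrightarrow> u n = f (n + 1) / l + w n * u (n + 1)" for n
      using l by (simp add: H_op_def w_def field_simps)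
    moreover have all: "(\<forall>n. Q n) \<longleftrightarrow> (\<forall>n. Q (n + 1))" for Q :: "int \<Rightarrow> bool"
      by (metis diff_add_cancel)
    ultimately show ?thesis by (subst all) simp
  qed
  show ?thesis
  proof (rule resolvent_setI[OF linear_on_sequences_H_op, where K = "C / (1 - q) / cmod l"])
    fix f assume f: "f \<in> ell2"
    define g where "g n = 1 / l * f (n + 1)" for n
    have g: "g \<in> ell2" "ell2_norm g \<le> cmod (1 / l) * ell2_norm f"
    proof -
      note d = ell2_dominated[OF ell2_shift(1)[OF f, of 1], of g "cmod (1 / l)"]
      show "g \<in> ell2" by (rule d) (simp_all add: g_def norm_mult norm_divide)
      have "ell2_norm g \<le> cmod (1 / l) * ell2_norm (\<lambda>n. f (n + 1))"
        by (rule d) (simp_all add: g_def norm_mult norm_divide)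
      also have "\<dots> \<le> cmod (1 / l) * ell2_norm f"
        by (intro mult_left_mono ell2_shift(2) f) simp
      finally show "ell2_norm g \<le> cmod (1 / l) * ell2_norm f" .
    qed
    obtain u where u: "u \<in> ell2" "ell2_norm u \<le> C / (1 - q) * ell2_norm g"
      "\<And>n. u n = g n + w n * u (n + 1)"
      using weighted_shift_solution[OF w q g(1)] by blast
    have "0 \<le> C" using w[where n = 0 and m = 0] by simp
    then have "C / (1 - q) * ell2_norm g \<le> C / (1 - q) * (cmod (1 / l) * ell2_norm f)"
      using q by (intro mult_left_mono g(2)) auto
    then have "ell2_norm u \<le> C / (1 - q) / cmod l * ell2_norm f"
      using u(2) by (simp add: norm_divide)
    then show "\<exists>u\<in>ell2. (\<forall>n. H_op V \<alpha> l \<theta> u n - z * u n = f n) \<and> ell2_norm u \<le> C / (1 - q) / cmod l * ell2_norm f"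
      unfolding eq by (intro bexI[OF _ u(1)] conjI allI) (subst u(3), simp add: g_def)
  next
    fix u n assume u: "u \<in> ell2" "\<And>n. H_op V \<alpha> l \<theta> u n = z * u n"
    have "\<forall>n. H_op V \<alpha> l \<theta> u n - z * u n = 0" by (simp add: u(2))
    note hom = spec[OF eq[of u "\<lambda>_. 0", THEN iffD1, OF this]]
    have "u n = w n * u (n + 1)" for n by (rule trans[OF hom]) simp
    then show "u n = 0" by (rule weighted_shift_kernel[OF w q u(1)])
  qed
qed

text \<open>
  Solving \<open>(H - z) u = f\<close> for the diagonal term gives a weighted shift in the other direction, with
  weights \<open>l / (z - V)\<close>. This form also covers \<open>l = 0\<close>.
\<close>

lemma resolvent_of_backward_contraction:
  assumes \<delta>: "0 < \<delta>" "\<And>x. \<delta> \<le> cmod (z - V x)" and q: "0 \<le> q" "q < 1"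
    and prod: "\<And>x m. (\<Prod>j<m. cmod (l / (z - V (x - of_nat j *\<^sub>R \<alpha>)))) \<le> C * q ^ m"
  shows "z \<in> resolvent_set (H_op V \<alpha> l \<theta>)"
proof -
  define w where "w n = l / (z - V (\<theta> + of_int n *\<^sub>R \<alpha>))" for n :: int
  have w: "cmod (\<Prod>j<m. w (n + int j * -1)) \<le> C * q ^ m" for n m
    using prod[where x = "\<theta> + of_int n *\<^sub>R \<alpha>" and m = m]
    by (simp add: w_def prod_norm[symmetric] algebra_simps)
  have nz: "z - V x \<noteq> 0" for x using \<delta>(1) \<delta>(2)[of x] by auto
  have eq: "H_op V \<alpha> l \<theta> u n - z * u n = f n \<longleftrightarrow>
      u n = f n / - (z - V (\<theta> + of_int n *\<^sub>R \<alpha>)) + w n * u (n + -1)" for u f n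
  proof -
    have "a * u' + v * x - z * x = y \<longleftrightarrow> x = y / - (z - v) + a / (z - v) * u'" if "z - v \<noteq> 0"
      for a u' v x y :: complex
    proof -
      have "y / - (z - v) + a / (z - v) * u' = (a * u' - y) / (z - v)"
        by (simp only: divide_minus_right diff_divide_distrib) simp
      moreover have "x = (a * u' - y) / (z - v) \<longleftrightarrow> x * (z - v) = a * u' - y"
        using that by (simp only: eq_divide_eq) simp
      moreover have "a * u' + v * x - z * x - y = - (x * (z - v) - (a * u' - y))"
        by (simp add: algebra_simps)
      ultimately show ?thesis by (metis eq_iff_diff_eq_0 neg_equal_0_iff_equal)
    qed
    from this[OF nz] show ?thesis by (simp add: H_op_def w_def)
  qed
  show ?thesis
  proof (rule resolvent_setI[OF linear_on_sequences_H_op, where K = "C / (1 - q) / \<delta>"])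
    fix f assume f: "f \<in> ell2"
    define g where "g n = f n / - (z - V (\<theta> + of_int n *\<^sub>R \<alpha>))" for n :: int
    have "cmod (g n) \<le> 1 / \<delta> * cmod (f n)" for n
      using \<delta> by (simp add: g_def norm_divide norm_minus_commute frac_le)
    then have g: "g \<in> ell2" "ell2_norm g \<le> 1 / \<delta> * ell2_norm f"
      using ell2_dominated[OF f, of g "1 / \<delta>"] \<delta>(1) by auto
    obtain u where u: "u \<in> ell2" "ell2_norm u \<le> C / (1 - q) * ell2_norm g"
      "\<And>n. u n = g n + w n * u (n + -1)"
      using weighted_shift_solution[OF w q g(1)] by blast
    have "0 \<le> C" using w[where n = 0 and m = 0] by simp
    then have "C / (1 - q) * ell2_norm g \<le> C / (1 - q) * (1 / \<delta> * ell2_norm f)"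
      using q by (intro mult_left_mono g(2)) auto
    then have "ell2_norm u \<le> C / (1 - q) / \<delta> * ell2_norm f" using u(2) by simp
    then show "\<exists>u\<in>ell2. (\<forall>n. H_op V \<alpha> l \<theta> u n - z * u n = f n) \<and> ell2_norm u \<le> C / (1 - q) / \<delta> * ell2_norm f"
      unfolding eq by (intro bexI[OF _ u(1)] conjI allI) (subst u(3), simp add: g_def)
  next
    fix u n assume u: "u \<in> ell2" "\<And>n. H_op V \<alpha> l \<theta> u n = z * u n"
    have "H_op V \<alpha> l \<theta> u n - z * u n = 0" for n by (simp add: u(2))
    note hom = eq[of u _ "\<lambda>_. 0", THEN iffD1, OF this]
    have "u n = w n * u (n + -1)" for n by (rule trans[OF hom]) simp
    then show "u n = 0" by (rule weighted_shift_kernel[OF w q u(1)])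
  qed
qed

section \<open>Points outside the spectrum\<close>

lemma integral_ln_divide_const:
  fixes g :: "real ^ 'd \<Rightarrow> real"
  assumes "continuous_on UNIV g" "\<And>x. 0 < g x" "0 < c"
  shows "(LINT x:unit_cube|lborel. ln (g x / c)) = (LINT x:unit_cube|lborel. ln (g x)) - ln c"
    and "(LINT x:unit_cube|lborel. ln (c / g x)) = ln c - (LINT x:unit_cube|lborel. ln (g x))"
proof -
  have int: "set_integrable lborel (unit_cube :: (real ^ 'd) set) (\<lambda>x. ln (g x))"
    "set_integrable lborel (unit_cube :: (real ^ 'd) set) (\<lambda>x. ln c)"
    using assms by (auto intro!: continuous_set_integrable_unit_cube continuous_on_ln simp: less_imp_neq[symmetric])
  have e: "ln (g x / c) = ln (g x) - ln c" "ln (c / g x) = ln c - ln (g x)" for x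
    using assms(2)[of x] assms(3) by (simp_all add: ln_div)
  show "(LINT x:unit_cube|lborel. ln (g x / c)) = (LINT x:unit_cube|lborel. ln (g x)) - ln c"
    "(LINT x:unit_cube|lborel. ln (c / g x)) = ln c - (LINT x:unit_cube|lborel. ln (g x))"
    unfolding e using int by (simp_all add: set_integral_diff integral_unit_cube_const)
qed

lemma continuous_on_dist_V:
  assumes "continuous_on UNIV V"
  shows "continuous_on UNIV (\<lambda>x. cmod (z - V x))"
  by (intro continuous_intros assms)

lemma range_complement_gap:
  fixes V :: "real ^ 'd \<Rightarrow> complex"
  assumes V: "lattice_periodic V" "continuous_on UNIV V" and z: "z \<notin> range V"
  obtains \<delta> where "0 < \<delta>" "\<And>x. \<delta> \<le> cmod (z - V x)"
proof -
  have "closed (range V)" using continuous_periodic_compact_range[OF V(2,1)] compact_imp_closed by blast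
  then obtain \<delta> where "0 < \<delta>" "\<And>y. y \<in> range V \<Longrightarrow> \<delta> \<le> dist z y"
    using separate_point_closed[OF _ z] by blast
  then show ?thesis using that by (auto simp: dist_norm)
qed

text \<open>
  Cutting off the logarithmic singularity replaces \<open>ln \<bar>z - V\<bar>\<close>, which may be unbounded below, by a
  larger continuous function whose integral is almost the same. An upper bound is all that is needed
  for the decay of products, so equidistribution of continuous functions applies.
\<close>

lemma truncated_log_integral_less:
  assumes cont: "continuous_on UNIV V" and ld: "log_dist_integrable V z" and s: "G V z < s"
  obtains \<delta> where "0 < \<delta>" "(LINT x:unit_cube|lborel. ln (max (cmod (z - V x)) \<delta>)) < s"
proof -
  note [measurable] = borel_measurable_continuous_onI[OF cont]
  let ?Q = "unit_cube :: (real ^ 'd) set"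
  define h where "h k x = indicator ?Q x *\<^sub>R ln (max (cmod (z - V x)) (1 / real (Suc k)))" for k x
  have "(\<lambda>k. integral\<^sup>L lborel (h k)) \<longlonglongrightarrow> (LINT x|lborel. indicator ?Q x *\<^sub>R ln (cmod (z - V x)))"
  proof (rule integral_dominated_convergence)
    show "integrable lborel (\<lambda>x. norm (indicator ?Q x *\<^sub>R ln (cmod (z - V x))))"
      using ld unfolding log_dist_integrable_def set_integrable_def by (intro integrable_norm) auto
    have ae: "AE x in lborel. x \<in> ?Q \<longrightarrow> V x \<noteq> z" using ld by (simp add: log_dist_integrable_def)
    show "AE x in lborel. (\<lambda>k. h k x) \<longlonglongrightarrow> indicator ?Q x *\<^sub>R ln (cmod (z - V x))"
      using ae
    proof eventually_elim
      case (elim x)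
      show ?case
      proof (cases "x \<in> ?Q")
        case True
        then have "0 < cmod (z - V x)" using elim by auto
        then have "(\<lambda>k. ln (max (cmod (z - V x)) (1 / real (Suc k)))) \<longlonglongrightarrow> ln (max (cmod (z - V x)) 0)"
          by (intro tendsto_ln tendsto_max tendsto_const LIMSEQ_Suc lim_1_over_n) auto
        then show ?thesis using True by (simp add: h_def max_absorb1)
      qed (simp add: h_def)
    qed
    show "AE x in lborel. norm (h k x) \<le> norm (indicator ?Q x *\<^sub>R ln (cmod (z - V x)))" for k
      using ae
    proof eventually_elim
      case (elim x)
      have "\<bar>ln (max t (1 / real (Suc k)))\<bar> \<le> \<bar>ln t\<bar>" if "0 < t" for t
      proof (cases "1 / real (Suc k) \<le> t")
        case False
        then have "ln t \<le> ln (1 / real (Suc k))" using that by simp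
        moreover have "ln (1 / real (Suc k)) \<le> 0" by simp
        ultimately show ?thesis using False by (simp add: max_def)
      qed (simp add: max_def)
      then show ?case using elim by (auto simp: h_def indicator_def)
    qed
  qed (unfold h_def, measurable)
  also have "(LINT x|lborel. indicator ?Q x *\<^sub>R ln (cmod (z - V x))) = G V z"
    by (simp add: G_def set_lebesgue_integral_def)
  finally have "\<forall>\<^sub>F k in sequentially. integral\<^sup>L lborel (h k) < s"
    using s by (rule order_tendstoD(2))
  then obtain k where "integral\<^sup>L lborel (h k) < s" unfolding eventually_sequentially by blast
  then show ?thesis
    using that[of "1 / real (Suc k)"] by (simp add: h_def[abs_def] set_lebesgue_integral_def)
qed

context
  fixes V :: "real ^ 'd \<Rightarrow> complex" and \<alpha> :: "real ^ 'd"
  assumes ri: "rationally_independent \<alpha>"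
    and per: "lattice_periodic V" and cont: "continuous_on UNIV V"
begin

lemma resolvent_if_G_less:
  assumes l: "l \<noteq> 0" and ld: "log_dist_integrable V z" and G: "G V z < ln (cmod l)"
  shows "z \<in> resolvent_set (H_op V \<alpha> l \<theta>)"
proof -
  obtain \<delta> where \<delta>: "0 < \<delta>" "(LINT x:unit_cube|lborel. ln (max (cmod (z - V x)) \<delta>)) < ln (cmod l)"
    using truncated_log_integral_less[OF cont ld G] .
  define g where "g x = max (cmod (z - V x)) \<delta>" for x
  have g: "continuous_on UNIV g" "\<And>x. 0 < g x" "lattice_periodic g"
    using \<delta>(1) unfolding g_def[abs_def]
    by (auto intro!: continuous_intros continuous_on_dist_V[OF cont] lattice_periodic_compose[OF per])
  define s where "s = ((LINT x:unit_cube|lborel. ln (g x)) - ln (cmod l)) / 2"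
  have s: "(LINT x:unit_cube|lborel. ln (g x)) - ln (cmod l) < s" "s < 0"
    using \<delta>(2) by (simp_all add: s_def g_def)
  obtain C where C: "\<And>n x. (\<Prod>j<n. g (x + of_nat j *\<^sub>R \<alpha>) / cmod l) \<le> C * exp s ^ n"
  proof (rule orbit_prod_exp_bound[OF ri, of "\<lambda>x. g x / cmod l" s])
    show "(LINT x:unit_cube|lborel. ln (g x / cmod l)) < s"
      using integral_ln_divide_const(1)[OF g(1,2), of "cmod l"] s(1) l by simp
  qed (use g l in \<open>auto intro!: continuous_intros lattice_periodic_compose[OF g(3)]\<close>)
  show ?thesis
  proof (rule resolvent_of_forward_contraction[OF l])
    show "(\<Prod>j<m. cmod ((z - V (x + of_nat j *\<^sub>R \<alpha>)) / l)) \<le> C * exp s ^ m" for x m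
    proof -
      have "(\<Prod>j<m. cmod ((z - V (x + of_nat j *\<^sub>R \<alpha>)) / l)) \<le> (\<Prod>j<m. g (x + of_nat j *\<^sub>R \<alpha>) / cmod l)"
        by (intro prod_mono) (auto simp: norm_divide g_def divide_right_mono)
      then show ?thesis using C order_trans by blast
    qed
  qed (use s in auto)
qed

lemma resolvent_if_G_greater:
  assumes l: "l \<noteq> 0" and z: "z \<notin> range V" and G: "ln (cmod l) < G V z"
  shows "z \<in> resolvent_set (H_op V \<alpha> l \<theta>)"
proof -
  obtain \<delta> where \<delta>: "0 < \<delta>" "\<And>x. \<delta> \<le> cmod (z - V x)" using range_complement_gap[OF per cont z] by blast
  define s where "s = (ln (cmod l) - G V z) / 2"
  have s: "ln (cmod l) - G V z < s" "s < 0" using G by (simp_all add: s_def)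
  have pos: "0 < cmod (z - V x)" for x using \<delta>(1) \<delta>(2)[of x] by linarith
  obtain C where C: "\<And>n x. (\<Prod>j<n. cmod l / cmod (z - V (x + of_nat j *\<^sub>R \<alpha>))) \<le> C * exp s ^ n"
  proof (rule orbit_prod_exp_bound[OF ri, of "\<lambda>x. cmod l / cmod (z - V x)" s])
    show "(LINT x:unit_cube|lborel. ln (cmod l / cmod (z - V x))) < s"
      using integral_ln_divide_const(2)[OF continuous_on_dist_V[OF cont] pos, of "cmod l"] s(1) l by (simp add: G_def)
    show "continuous_on UNIV (\<lambda>x. cmod l / cmod (z - V x))"
      by (intro continuous_intros cont) (use z in auto)
  qed (use pos l in \<open>auto intro!: lattice_periodic_compose[OF per]\<close>)
  show ?thesis
  proof (rule resolvent_of_backward_contraction[OF \<delta>])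
    show "(\<Prod>j<m. cmod (l / (z - V (x - of_nat j *\<^sub>R \<alpha>)))) \<le> C * exp s ^ m" for x m
      using C prod_reverse_orbit[of "\<lambda>x. cmod (l / (z - V x))" x \<alpha> m] by (simp add: norm_divide)
  qed (use s in auto)
qed

end

section \<open>Points of the spectrum\<close>

text \<open>
  The homogeneous equation \<open>H u = z u\<close> is \<open>u (n - 1) = A (\<theta> + n \<alpha>) * u n\<close> with this \<open>A\<close>, for \<open>l \<noteq> 0\<close>.
\<close>

definition cocycle :: "(real ^ 'd \<Rightarrow> complex) \<Rightarrow> complex \<Rightarrow> complex \<Rightarrow> real ^ 'd \<Rightarrow> complex" where
  "cocycle V l z x = (z - V x) / l"

definition backward_product ::
    "(real ^ 'd \<Rightarrow> complex) \<Rightarrow> complex \<Rightarrow> complex \<Rightarrow> real ^ 'd \<Rightarrow> nat \<Rightarrow> real ^ 'd \<Rightarrow> complex" where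
  "backward_product V l z \<alpha> m x = (\<Prod>i<m. cocycle V l z (x - of_nat i *\<^sub>R \<alpha>))"

lemma H_op_cocycle:
  assumes "l \<noteq> 0"
  shows "H_op V \<alpha> l \<theta> u n - z * u n = l * (u (n - 1) - cocycle V l z (\<theta> + of_int n *\<^sub>R \<alpha>) * u n)"
  using assms by (simp add: H_op_def cocycle_def field_simps)

text \<open>
  The column of the inverse of \<open>H - z\<close> belonging to position \<open>k + 1\<close> solves the homogeneous equation
  away from \<open>k\<close>. If the product over the \<open>j\<close> positions after \<open>k\<close> is small, as it is when \<open>A\<close> nearly
  vanishes at position \<open>k + j\<close>, then values to the right hardly influence \<open>u k\<close>, which is therefore close
  to \<open>1\<close>; to the left of \<open>k\<close>, the column consists of the backward products times \<open>u k\<close>.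
\<close>

lemma backward_products_square_summable:
  assumes l: "l \<noteq> 0" and K: "0 \<le> K"
    and solve: "\<And>f. f \<in> ell2 \<Longrightarrow>
      \<exists>u\<in>ell2. (\<lambda>n. H_op V \<alpha> l \<theta> u n - z * u n) = f \<and> ell2_norm u \<le> K * ell2_norm f"
    and small: "cmod (\<Prod>i<j. cocycle V l z (\<theta> + of_int (k + 1 + int i) *\<^sub>R \<alpha>)) * (K * cmod l) \<le> 1 / 2"
    and j: "1 \<le> j"
  shows "(\<Sum>m<M. (cmod (backward_product V l z \<alpha> m (\<theta> + of_int k *\<^sub>R \<alpha>)))\<^sup>2) \<le> (2 * K * cmod l)\<^sup>2"
proof -
  define A where "A n = cocycle V l z (\<theta> + of_int n *\<^sub>R \<alpha>)" for n :: int
  \<comment> \<open>The factor \<open>l\<close> and the index \<open>k + 1\<close> make the inhomogeneity a unit at \<open>k\<close> in the recursion below.\<close>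
  define f where "f n = l * unit_seq (k + 1) n" for n
  have f: "f \<in> ell2" "ell2_norm f \<le> cmod l"
    using ell2_dominated[OF unit_seq_ell2, of f "cmod l" "k + 1"]
    by (simp_all add: f_def norm_mult ell2_norm_unit_seq)
  obtain u where u: "u \<in> ell2" "(\<lambda>n. H_op V \<alpha> l \<theta> u n - z * u n) = f" "ell2_norm u \<le> K * ell2_norm f"
    using solve[OF f(1)] by blast
  have norm_u: "ell2_norm u \<le> K * cmod l"
    using u(3) mult_left_mono[OF f(2) K] by linarith
  have rec: "u n = unit_seq k n + A (n + 1) * u (n + 1)" for n
  proof -
    have "l * (u n - A (n + 1) * u (n + 1)) = l * unit_seq (k + 1) (n + 1)"
      using fun_cong[OF u(2), of "n + 1"] H_op_cocycle[OF l, of V \<alpha> \<theta> u "n + 1" z]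
      by (simp add: f_def A_def)
    then have "u n - A (n + 1) * u (n + 1) = unit_seq k n"
      using l by (simp only: mult_cancel_left) (simp add: unit_seq_def)
    then show ?thesis by (simp add: algebra_simps)
  qed
  have forward: "u k = 1 + (\<Prod>i<Suc i. A (k + 1 + int i)) * u (k + int (Suc i))" for i
  proof (induction i)
    case 0
    show ?case using rec[of k] by (simp add: unit_seq_def)
  next
    case (Suc i)
    have "u (k + int (Suc i)) = A (k + 1 + int (Suc i)) * u (k + int (Suc (Suc i)))"
      using rec[of "k + int (Suc i)"] by (simp add: unit_seq_def algebra_simps)
    then show ?case using Suc by (simp add: mult_ac)
  qed
  have "cmod (u k - 1) = cmod (\<Prod>i<j. A (k + 1 + int i)) * cmod (u (k + int j))"
    using forward[of "j - 1"] j by (simp add: norm_mult)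
  also have "\<dots> \<le> cmod (\<Prod>i<j. A (k + 1 + int i)) * (K * cmod l)"
    using cmod_le_ell2_norm[OF u(1)] norm_u by (intro mult_left_mono order_trans[OF _ norm_u]) auto
  finally have "cmod (u k - 1) \<le> 1 / 2" using small by (simp add: A_def)
  then have uk: "1 / 2 \<le> cmod (u k)"
    using norm_triangle_ineq2[of 1 "1 - u k"] by (simp add: norm_minus_commute)
  have backward: "u (k - int m) = (\<Prod>i<m. A (k - int i)) * u k" for m
  proof (induction m)
    case (Suc m)
    have "u (k - int (Suc m)) = A (k - int m) * u (k - int m)"
      using rec[of "k - int (Suc m)"] by (simp add: unit_seq_def)
    then show ?case using Suc by simp
  qed simp
  have bp: "backward_product V l z \<alpha> m (\<theta> + of_int k *\<^sub>R \<alpha>) = (\<Prod>i<m. A (k - int i))" for m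
    unfolding backward_product_def A_def by (simp add: algebra_simps)
  have "(\<Sum>m<M. (cmod (\<Prod>i<m. A (k - int i)))\<^sup>2) * (1 / 2)\<^sup>2
      \<le> (\<Sum>m<M. (cmod (\<Prod>i<m. A (k - int i)))\<^sup>2) * (cmod (u k))\<^sup>2"
    using uk by (intro mult_left_mono power_mono sum_nonneg) auto
  also have "\<dots> = (\<Sum>n\<in>(\<lambda>m. k - int m) ` {..<M}. (cmod (u n))\<^sup>2)"
    by (subst sum.reindex) (auto simp: inj_on_def backward norm_mult power_mult_distrib sum_distrib_right)
  also have "\<dots> = (L2_set (\<lambda>n. cmod (u n)) ((\<lambda>m. k - int m) ` {..<M}))\<^sup>2"
    by (simp add: L2_set_def sum_nonneg)
  also have "\<dots> \<le> (K * cmod l)\<^sup>2"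
    by (intro power_mono order_trans[OF ell2_L2_set_le[OF u(1)] norm_u]) simp
  finally show ?thesis unfolding bp by (simp add: power2_eq_square algebra_simps)
qed

lemma lattice_periodic_cocycle: "lattice_periodic V \<Longrightarrow> lattice_periodic (cocycle V l z)"
  unfolding cocycle_def[abs_def] by (rule lattice_periodic_compose)

lemma continuous_on_cocycle:
  assumes "continuous_on UNIV V" "l \<noteq> 0"
  shows "continuous_on UNIV (cocycle V l z)"
  unfolding cocycle_def[abs_def] using assms by (intro continuous_intros) auto

lemma continuous_on_shift:
  fixes f :: "'a :: real_normed_vector \<Rightarrow> 'b :: topological_space"
  assumes "continuous_on UNIV f"
  shows "continuous_on UNIV (\<lambda>x. f (x + t))"
  by (rule continuous_on_compose2[OF assms]) (auto intro!: continuous_intros)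

lemma continuous_on_backward_product:
  assumes "continuous_on UNIV V" "l \<noteq> 0"
  shows "continuous_on UNIV (backward_product V l z \<alpha> m)"
  unfolding backward_product_def[abs_def] diff_conv_add_uminus
  by (intro continuous_on_prod continuous_on_shift continuous_on_cocycle assms)

lemma lattice_periodic_backward_product:
  assumes "lattice_periodic V"
  shows "lattice_periodic (backward_product V l z \<alpha> m)"
  unfolding lattice_periodic_def backward_product_def diff_conv_add_uminus
  by (intro allI ballI prod.cong refl
      lattice_periodicD[OF lattice_periodic_shift[OF lattice_periodic_cocycle[OF assms]]])

text \<open>
  The level set of \<open>z\<close> is a null set on the torus, and so are its translates.
\<close>

lemma AE_translate_ne:
  fixes V :: "real ^ 'd \<Rightarrow> complex"
  assumes per: "lattice_periodic V" and cont: "continuous_on UNIV V" and ld: "log_dist_integrable V z"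
  shows "AE x in lborel. x \<in> unit_cube \<longrightarrow> V (x + t) \<noteq> z"
proof -
  note [measurable] = borel_measurable_continuous_onI[OF cont]
  define h where "h x = (indicator {z} (V x) :: ennreal)" for x
  have [measurable]: "h \<in> borel_measurable borel" unfolding h_def[abs_def] by measurable
  have per_h: "lattice_periodic h" unfolding h_def[abs_def] by (rule lattice_periodic_compose[OF per])
  have "AE x in lborel. h x * indicator unit_cube x = 0"
    using ld unfolding log_dist_integrable_def by (auto simp: h_def indicator_def elim!: eventually_mono)
  then have "(\<integral>\<^sup>+x. h (x + t) * indicator unit_cube x \<partial>lborel) = 0"
    using per_h by (simp add: nn_integral_unit_cube_translate nn_integral_0_iff_AE)
  then have "AE x in lborel. h (x + t) * indicator unit_cube x = 0"
    by (simp add: nn_integral_0_iff_AE)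
  then show ?thesis by eventually_elim (auto simp: h_def indicator_def)
qed

text \<open>
  Jensen's inequality in its elementary form \<open>ln p \<le> p - 1\<close>, for \<open>p\<close> the squared modulus of the product:
  the integral of \<open>ln p\<close> is \<open>2 m (G V z - ln \<bar>l\<bar>) \<ge> 0\<close>. The zeros of the product, where \<open>ln\<close> has the
  wrong value, form a null set.
\<close>

lemma integral_backward_product_ge:
  fixes V :: "real ^ 'd \<Rightarrow> complex"
  assumes per: "lattice_periodic V" and cont: "continuous_on UNIV V" and l: "l \<noteq> 0" and ld: "log_dist_integrable V z" and G: "ln (cmod l) \<le> G V z"
  shows "1 \<le> (LINT x:unit_cube|lborel. (cmod (backward_product V l z \<alpha> m x))\<^sup>2)"
proof -
  note [measurable] = borel_measurable_continuous_onI[OF cont]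
  let ?Q = "unit_cube :: (real ^ 'd) set"
  define h where "h x = ln (cmod (z - V x))" for x
  have h: "h \<in> borel_measurable borel" "lattice_periodic h" "set_integrable lborel ?Q h"
    using ld lattice_periodic_compose[OF per] unfolding h_def[abs_def] log_dist_integrable_def by auto
  define L where "L x = 1 + 2 * (orbit_sum (- \<alpha>) h m x - of_nat m * ln (cmod l))" for x
  note os = integral_orbit_sum[OF h, of "- \<alpha>" m]
  have ci: "set_integrable lborel ?Q (\<lambda>_. c :: real)" for c
    by (rule continuous_set_integrable_unit_cube) simp
  have intL: "set_integrable lborel ?Q L"
    unfolding L_def[abs_def] by (intro set_integral_add(1) set_integrable_mult_right set_integral_diff(1) ci os(1))
  have "1 \<le> 1 + 2 * (of_nat m * G V z - of_nat m * ln (cmod l))"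
    using G by (simp add: mult_left_mono)
  also have "\<dots> = (LINT x:?Q|lborel. L x)"
    unfolding L_def
    by (subst set_integral_add(2)[OF ci])
       (simp_all add: set_integral_diff os ci integral_unit_cube_const G_def h_def[symmetric])
  also have "\<dots> \<le> (LINT x:?Q|lborel. (cmod (backward_product V l z \<alpha> m x))\<^sup>2)"
  proof (rule set_integral_mono_AE[OF intL])
    show "set_integrable lborel ?Q (\<lambda>x. (cmod (backward_product V l z \<alpha> m x))\<^sup>2)"
      by (intro continuous_set_integrable_unit_cube continuous_intros continuous_on_backward_product cont l)
    have "AE x in lborel. \<forall>j::nat. x \<in> ?Q \<longrightarrow> V (x + - (of_nat j *\<^sub>R \<alpha>)) \<noteq> z"
      unfolding AE_all_countable using AE_translate_ne[OF per cont ld] by blast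
    then show "AE x\<in>?Q in lborel. L x \<le> (cmod (backward_product V l z \<alpha> m x))\<^sup>2"
    proof eventually_elim
      case (elim x)
      show ?case
      proof
        assume "x \<in> ?Q"
        then have nz: "0 < cmod (z - V (x - of_nat j *\<^sub>R \<alpha>))" for j using elim by auto
        have "ln (cmod (backward_product V l z \<alpha> m x)) = (\<Sum>j<m. ln (cmod (z - V (x - of_nat j *\<^sub>R \<alpha>)) / cmod l))"
          unfolding backward_product_def cocycle_def prod_norm[symmetric] norm_divide
          using nz l by (intro ln_prod) auto
        also have "\<dots> = orbit_sum (- \<alpha>) h m x - of_nat m * ln (cmod l)"
          using nz l by (simp add: ln_div orbit_sum_def h_def sum_subtractf)
        finally have "L x = 1 + ln ((cmod (backward_product V l z \<alpha> m x))\<^sup>2)"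
          by (simp add: L_def ln_realpow)
        moreover have "0 < cmod (backward_product V l z \<alpha> m x)"
          using nz l by (auto simp: backward_product_def cocycle_def)
        ultimately show "L x \<le> (cmod (backward_product V l z \<alpha> m x))\<^sup>2"
          using ln_le_minus_one[of "(cmod (backward_product V l z \<alpha> m x))\<^sup>2"] by simp
      qed
    qed
  qed
  finally show ?thesis .
qed

context
  fixes V :: "real ^ 'd \<Rightarrow> complex" and \<alpha> :: "real ^ 'd"
  assumes ri: "rationally_independent \<alpha>"
    and per: "lattice_periodic V" and cont: "continuous_on UNIV V"
begin

text \<open>
  The starting points that satisfy the bound form a closed lattice-periodic set. It contains
  \<open>x\<^sub>0 - j \<alpha>\<close> for every \<open>j \<ge> 1\<close>, because the orbit of \<open>\<theta>\<close> visits every neighbourhood of the zero \<open>x\<^sub>0\<close> of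
  \<open>A\<close>, and the positions \<open>j\<close> steps before such visits satisfy the bound and come arbitrarily close to
  \<open>x\<^sub>0 - j \<alpha>\<close>. So it contains a dense half orbit.
\<close>

lemma backward_products_uniformly_square_summable:
  assumes l: "l \<noteq> 0" and K: "0 \<le> K"
    and solve: "\<And>f. f \<in> ell2 \<Longrightarrow>
      \<exists>u\<in>ell2. (\<lambda>n. H_op V \<alpha> l \<theta> u n - z * u n) = f \<and> ell2_norm u \<le> K * ell2_norm f"
    and x0: "V x0 = z"
  shows "(\<Sum>m<M. (cmod (backward_product V l z \<alpha> m x))\<^sup>2) \<le> (2 * K * cmod l)\<^sup>2"
proof -
  define F where "F x = (\<Sum>m<M. (cmod (backward_product V l z \<alpha> m x))\<^sup>2)" for x
  define S where "S = {x. F x \<le> (2 * K * cmod l)\<^sup>2}"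
  have "continuous_on UNIV F"
    unfolding F_def[abs_def] by (intro continuous_intros continuous_on_backward_product cont l)
  then have "closed S" unfolding S_def by (intro closed_Collect_le continuous_intros)
  have perS: "y + m \<in> S" if "y \<in> S" "m \<in> int_lattice" for y m
    using that lattice_periodicD[OF lattice_periodic_backward_product[OF per]] by (simp add: S_def F_def)
  have orb: "x0 - of_nat j *\<^sub>R \<alpha> \<in> S" if j: "1 \<le> j" for j
  proof -
    \<comment> \<open>\<open>W (\<theta> + p \<alpha>)\<close> is the quantity that must be small for the position \<open>k = p - j\<close>.\<close>
    define W where "W x = cmod (\<Prod>i<j. cocycle V l z (x + (1 + of_nat i - of_nat j) *\<^sub>R \<alpha>)) * (K * cmod l)" for x
    have contW: "continuous_on UNIV W"
      unfolding W_def[abs_def]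
      by (intro continuous_intros continuous_on_shift continuous_on_cocycle cont l)
    have "\<exists>i<j. cocycle V l z (x0 + (1 + of_nat i - of_nat j) *\<^sub>R \<alpha>) = 0"
      using j x0 by (intro exI[of _ "j - 1"]) (simp add: cocycle_def of_nat_diff)
    then have "W x0 = 0" by (auto simp: W_def)
    moreover have "(W \<longlongrightarrow> W x0) (nhds x0)"
      using contW by (simp add: continuous_on_eq_continuous_at isCont_def tendsto_at_iff_tendsto_nhds)
    ultimately have "\<forall>\<^sub>F x in nhds x0. W x < 1 / 2"
      by (intro order_tendstoD(2)[of W "W x0"]) auto
    then obtain \<delta> where \<delta>: "0 < \<delta>" "\<And>x. dist x x0 < \<delta> \<Longrightarrow> W x < 1 / 2"
      unfolding eventually_nhds_metric by blast
    have "\<exists>y\<in>S. dist y (x0 - of_nat j *\<^sub>R \<alpha>) < \<epsilon>" if \<epsilon>: "0 < \<epsilon>" for \<epsilon>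
    proof -
      have "0 < min \<delta> \<epsilon>" using \<delta>(1) \<epsilon> by simp
      then obtain p m where p: "m \<in> int_lattice" "dist (of_int p *\<^sub>R \<alpha> + m) (x0 - \<theta>) < min \<delta> \<epsilon>"
        using orbit_dense_mod_lattice[OF ri] by metis
      let ?y = "\<theta> + of_int p *\<^sub>R \<alpha>"
      have y: "dist (?y + m) x0 < min \<delta> \<epsilon>" using p(2) by (simp add: dist_norm algebra_simps)
      have "W (?y + m) = W ?y"
        using lattice_periodicD[OF lattice_periodic_shift[OF lattice_periodic_cocycle[OF per]] p(1)]
        by (simp add: W_def)
      then have "W ?y \<le> 1 / 2" using \<delta>(2)[of "?y + m"] y by simp
      then have "cmod (\<Prod>i<j. cocycle V l z (\<theta> + of_int (p - int j + 1 + int i) *\<^sub>R \<alpha>)) * (K * cmod l) \<le> 1 / 2"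
        by (simp add: W_def algebra_simps)
      from backward_products_square_summable[OF l K solve this j, of M]
      have "\<theta> + of_int (p - int j) *\<^sub>R \<alpha> \<in> S" by (simp add: S_def F_def)
      from perS[OF this p(1)] have "\<theta> + of_int (p - int j) *\<^sub>R \<alpha> + m \<in> S" .
      moreover have "dist (\<theta> + of_int (p - int j) *\<^sub>R \<alpha> + m) (x0 - of_nat j *\<^sub>R \<alpha>) = dist (?y + m) x0"
        by (simp add: dist_norm algebra_simps)
      ultimately show ?thesis using y
        by (intro bexI[of _ "\<theta> + of_int (p - int j) *\<^sub>R \<alpha> + m"]) auto
    qed
    then show ?thesis using \<open>closed S\<close> closure_approachable closure_closed by blast
  qed
  have "x \<in> S" by (rule closed_backward_orbit_UNIV[OF ri \<open>closed S\<close> perS orb])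
  then show ?thesis by (simp add: S_def F_def)
qed

text \<open>
  If \<open>H - z\<close> had a bounded inverse, the mean squares of the backward products, each at least \<open>1\<close>, would
  have bounded sums.
\<close>

lemma spectrum_on_range:
  assumes l: "l \<noteq> 0" and ld: "log_dist_integrable V z" and G: "ln (cmod l) \<le> G V z"
    and z: "z \<in> range V"
  shows "z \<notin> resolvent_set (H_op V \<alpha> l \<theta>)"
proof
  assume "z \<in> resolvent_set (H_op V \<alpha> l \<theta>)"
  then obtain K where K: "0 \<le> K" "\<And>f. f \<in> ell2 \<Longrightarrow>
      \<exists>u\<in>ell2. (\<lambda>n. H_op V \<alpha> l \<theta> u n - z * u n) = f \<and> ell2_norm u \<le> K * ell2_norm f"
    by (rule resolvent_setE) blast
  obtain x0 where x0: "V x0 = z" using z by blast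
  let ?Q = "unit_cube :: (real ^ 'd) set" and ?D = "(2 * K * cmod l)\<^sup>2"
  let ?P = "\<lambda>m x. (cmod (backward_product V l z \<alpha> m x))\<^sup>2"
  obtain M :: nat where M: "?D < of_nat M" using reals_Archimedean2 by blast
  have int: "set_integrable lborel ?Q (?P m)" for m
    by (intro continuous_set_integrable_unit_cube continuous_intros continuous_on_backward_product cont l)
  have "real M \<le> (\<Sum>m<M. LINT x:?Q|lborel. ?P m x)"
    using sum_mono[of "{..<M}" "\<lambda>_. 1", OF integral_backward_product_ge[OF per cont l ld G]] by simp
  also have "\<dots> = (LINT x:?Q|lborel. \<Sum>m<M. ?P m x)"
    using int unfolding set_lebesgue_integral_def set_integrable_def scaleR_sum_right
    by (intro Bochner_Integration.integral_sum[symmetric])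
  also have "\<dots> \<le> (LINT x:?Q|lborel. ?D)"
    by (intro set_integral_mono backward_products_uniformly_square_summable[OF l K x0]
        continuous_set_integrable_unit_cube continuous_intros continuous_on_backward_product cont l)
  also have "\<dots> = ?D" by (rule integral_unit_cube_const)
  finally show False using M by simp
qed

text \<open>
  Let \<open>u\<close> be the solution of the homogeneous equation with \<open>u 0 = 1\<close>. Since \<open>ln \<bar>A\<bar>\<close> is continuous with
  integral \<open>0\<close>, \<open>\<bar>u n\<bar>\<close> is at most a constant times \<open>exp s ^ \<bar>n\<bar>\<close> for every \<open>s > 0\<close>. Damping
  it by \<open>r ^ \<bar>n\<bar>\<close> with \<open>r = exp (- 2 s)\<close> makes it square summable, and since neighbouring damping factors
  differ by a factor between \<open>r\<close> and \<open>1 / r\<close>, the damped sequence nearly solves the equation.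
\<close>

lemma spectrum_critical:
  assumes l: "l \<noteq> 0" and z: "z \<notin> range V" and G: "G V z = ln (cmod l)"
  shows "z \<notin> resolvent_set (H_op V \<alpha> l \<theta>)"
proof
  assume "z \<in> resolvent_set (H_op V \<alpha> l \<theta>)"
  then obtain K where K: "0 \<le> K" "\<And>u. u \<in> ell2 \<Longrightarrow> (\<lambda>n. H_op V \<alpha> l \<theta> u n - z * u n) \<in> ell2 \<Longrightarrow>
      ell2_norm u \<le> K * ell2_norm (\<lambda>n. H_op V \<alpha> l \<theta> u n - z * u n)"
    by (rule resolvent_setE) blast
  \<comment> \<open>The approximate eigenvector \<open>v\<close> below has relative error at most \<open>\<bar>l\<bar> \<eta>\<close>, too small for \<open>K\<close>.\<close>
  define \<eta> where "\<eta> = 1 / (2 * (K * cmod l + 1))"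
  have Kl: "0 \<le> K * cmod l" using K(1) by simp
  then have "0 < K * cmod l + 1" by linarith
  then have \<eta>: "0 < \<eta>" "K * (cmod l * \<eta>) < 1"
    using Kl unfolding \<eta>_def by (simp, simp add: divide_less_eq mult.assoc[symmetric])
  \<comment> \<open>Chosen so that \<open>1 / r = 1 + \<eta>\<close> for \<open>r = exp (- 2 s)\<close>.\<close>
  define s where "s = ln (1 + \<eta>) / 2"
  have s: "0 < s" "exp s ^ 2 = 1 + \<eta>" using \<eta>(1) by (simp_all add: s_def exp_of_nat2_mult[symmetric])
  have pos: "0 < cmod (z - V x)" for x using z by auto
  let ?A = "\<lambda>n::int. cocycle V l z (\<theta> + of_int n *\<^sub>R \<alpha>)"
  have nz: "?A n \<noteq> 0" for n using pos l by (simp add: cocycle_def)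
  note int = integral_ln_divide_const[OF continuous_on_dist_V[OF cont] pos, of "cmod l"]
  obtain C1 where C1: "0 < C1" "\<And>n x. (\<Prod>j<n. cmod (z - V (x + of_nat j *\<^sub>R \<alpha>)) / cmod l) \<le> C1 * exp s ^ n"
  proof (rule orbit_prod_exp_bound[OF ri, of "\<lambda>x. cmod (z - V x) / cmod l" s])
    show "(LINT x:unit_cube|lborel. ln (cmod (z - V x) / cmod l)) < s"
      using int(1) s(1) l G by (simp add: G_def)
  qed (use pos l in \<open>auto intro!: continuous_intros cont lattice_periodic_compose[OF per]\<close>)
  obtain C2 where C2: "0 < C2" "\<And>n x. (\<Prod>j<n. cmod l / cmod (z - V (x + of_nat j *\<^sub>R \<alpha>))) \<le> C2 * exp s ^ n"
  proof (rule orbit_prod_exp_bound[OF ri, of "\<lambda>x. cmod l / cmod (z - V x)" s])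
    show "(LINT x:unit_cube|lborel. ln (cmod l / cmod (z - V x))) < s"
      using int(2) s(1) l G by (simp add: G_def)
    show "continuous_on UNIV (\<lambda>x. cmod l / cmod (z - V x))"
      by (intro continuous_intros cont) (use z in auto)
  qed (use pos l in \<open>auto intro!: lattice_periodic_compose[OF per]\<close>)
  define u where "u n = (if 0 \<le> n then \<Prod>j<nat n. inverse (?A (1 + int j)) else \<Prod>j<nat (- n). ?A (- int j))" for n
  have rec: "u (n - 1) = ?A n * u n" for n
  proof (cases "1 \<le> n")
    case True
    then have "nat n = Suc (nat (n - 1))" "1 + int (nat (n - 1)) = n" by auto
    then have "u n = u (n - 1) * inverse (?A n)" using True by (simp add: u_def del: of_int_add)
    then show ?thesis using nz[of n] by (simp add: field_simps)
  next
    case False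
    then have "nat (- (n - 1)) = Suc (nat (- n))" "- int (nat (- n)) = n" by auto
    then show ?thesis using False by (cases "n = 0") (simp_all add: u_def mult.commute del: of_int_minus)
  qed
  have bound: "cmod (u n) \<le> max C1 C2 * exp s ^ nat \<bar>n\<bar>" for n
  proof (cases "0 \<le> n")
    case True
    have "cmod (u n) = (\<Prod>j<nat n. cmod l / cmod (z - V (\<theta> + \<alpha> + of_nat j *\<^sub>R \<alpha>)))"
      using True by (simp add: u_def cocycle_def prod_norm[symmetric] norm_divide norm_inverse algebra_simps)
    also have "\<dots> \<le> C2 * exp s ^ nat \<bar>n\<bar>" using C2(2) True by simp
    also have "\<dots> \<le> max C1 C2 * exp s ^ nat \<bar>n\<bar>" by (intro mult_right_mono) auto
    finally show ?thesis .
  next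
    case False
    have "cmod (u n) = (\<Prod>j<nat (- n). cmod (z - V (\<theta> - of_nat j *\<^sub>R \<alpha>)) / cmod l)"
      using False by (simp add: u_def cocycle_def prod_norm[symmetric] norm_divide)
    also have "\<dots> \<le> C1 * exp s ^ nat \<bar>n\<bar>"
      using C1(2) False prod_reverse_orbit[of "\<lambda>x. cmod (z - V x) / cmod l" \<theta> \<alpha> "nat (- n)"] by simp
    also have "\<dots> \<le> max C1 C2 * exp s ^ nat \<bar>n\<bar>" by (intro mult_right_mono) auto
    finally show ?thesis .
  qed
  define r where "r = inverse (exp s ^ 2)"
  have r: "0 < r" "r < 1" "r * (1 + \<eta>) = 1" using s \<eta>(1) unfolding r_def by (simp_all add: field_simps)
  define v where "v n = u n * of_real (r ^ nat \<bar>n\<bar>)" for n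
  have v: "v \<in> ell2"
  proof (rule ell2_geometric_decay)
    show "cmod (v n) \<le> max C1 C2 * inverse (exp s) ^ nat \<bar>n\<bar>" for n
    proof -
      have "cmod (v n) \<le> max C1 C2 * exp s ^ nat \<bar>n\<bar> * r ^ nat \<bar>n\<bar>"
        using r(1) unfolding v_def norm_mult
        by (intro mult_mono bound order_trans[OF norm_ge_zero bound]) (auto simp: norm_power)
      also have "\<dots> = max C1 C2 * (exp s * r) ^ nat \<bar>n\<bar>" by (simp add: power_mult_distrib)
      also have "exp s * r = inverse (exp s)" by (simp add: r_def power2_eq_square)
      finally show ?thesis .
    qed
  qed (use s(1) in \<open>auto simp: inverse_less_1_iff\<close>)
  let ?d = "\<lambda>n. H_op V \<alpha> l \<theta> v n - z * v n"
  have "cmod (?d n) \<le> cmod l * \<eta> * cmod (v (n + -1))" for n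
  proof -
    define a where "a = r ^ nat \<bar>n - 1\<bar>"
    define b where "b = r ^ nat \<bar>n\<bar>"
    have "?d n = l * u (n - 1) * (of_real a - of_real b)"
      using H_op_cocycle[OF l, of V \<alpha> \<theta> v n z] rec[of n] by (simp add: v_def a_def b_def algebra_simps)
    then have "cmod (?d n) = cmod l * cmod (u (n - 1)) * \<bar>a - b\<bar>"
      by (simp add: norm_mult flip: of_real_diff)
    moreover have "\<bar>a - b\<bar> \<le> \<eta> * a"
    proof (cases "1 \<le> n")
      case True
      then have "nat \<bar>n\<bar> = Suc (nat \<bar>n - 1\<bar>)" by auto
      then have b: "b = r * a" by (simp only: a_def b_def power_Suc)
      have a: "0 \<le> a" using r(1) by (simp add: a_def)
      have "r * a \<le> a" using r a by (intro mult_left_le_one_le) auto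
      then have "\<bar>a - b\<bar> = (1 - r) * a" by (simp add: b left_diff_distrib)
      also have "1 - r = r * \<eta>" using r(3) by (simp add: algebra_simps)
      also have "r * \<eta> * a \<le> \<eta> * a"
        using r \<eta>(1) a by (intro mult_right_mono mult_left_le_one_le) auto
      finally show ?thesis .
    next
      case False
      then have "nat \<bar>n - 1\<bar> = Suc (nat \<bar>n\<bar>)" by auto
      then have "a = r * b" by (simp only: a_def b_def power_Suc)
      then have "(1 + \<eta>) * a = r * (1 + \<eta>) * b" by simp
      then have "b = (1 + \<eta>) * a" using r(3) by simp
      moreover have "0 \<le> \<eta> * a" using r(1) \<eta>(1) by (simp add: a_def)
      ultimately show ?thesis by (simp add: algebra_simps)
    qed
    moreover have "cmod (v (n + -1)) = cmod (u (n - 1)) * a"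
      using r(1) by (simp add: v_def a_def norm_mult norm_power)
    ultimately show ?thesis
      using mult_left_mono[of "\<bar>a - b\<bar>" "\<eta> * a" "cmod l * cmod (u (n - 1))"] by (simp add: mult_ac)
  qed
  from ell2_dominated[OF ell2_shift(1)[OF v, of "-1"], of ?d, OF this]
  have d: "?d \<in> ell2" "ell2_norm ?d \<le> cmod l * \<eta> * ell2_norm (\<lambda>n. v (n + -1))"
    using \<eta>(1) by auto
  have "ell2_norm ?d \<le> cmod l * \<eta> * ell2_norm v"
    using d(2) mult_left_mono[OF ell2_shift(2)[OF v, of "-1"], of "cmod l * \<eta>"] \<eta>(1) by simp
  then have "ell2_norm v \<le> K * (cmod l * \<eta> * ell2_norm v)"
    using K(2)[OF v d(1)] mult_left_mono[OF _ K(1)] order_trans by blast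
  moreover have "1 \<le> ell2_norm v"
    using cmod_le_ell2_norm[OF v, of 0] by (simp add: v_def u_def)
  ultimately show False
    using mult_strict_right_mono[OF \<eta>(2), of "ell2_norm v"] by (simp add: mult_ac)
qed

text \<open>
  Values of \<open>V\<close> are approximated by values along the orbit, where unit sequences are eigenvectors of
  the multiplication.
\<close>

lemma spectrum_multiplication:
  "z \<in> resolvent_set (H_op V \<alpha> 0 \<theta>) \<longleftrightarrow> z \<notin> range V"
proof
  assume z: "z \<notin> range V"
  obtain \<delta> where \<delta>: "0 < \<delta>" "\<And>x. \<delta> \<le> cmod (z - V x)" using range_complement_gap[OF per cont z] by blast
  show "z \<in> resolvent_set (H_op V \<alpha> 0 \<theta>)"
    by (rule resolvent_of_backward_contraction[OF \<delta>, where q = 0 and C = 1])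
       (auto simp: power_0_left)
next
  assume "z \<in> resolvent_set (H_op V \<alpha> 0 \<theta>)"
  then obtain K where K: "0 \<le> K" "\<And>u. u \<in> ell2 \<Longrightarrow> (\<lambda>n. H_op V \<alpha> 0 \<theta> u n - z * u n) \<in> ell2 \<Longrightarrow>
      ell2_norm u \<le> K * ell2_norm (\<lambda>n. H_op V \<alpha> 0 \<theta> u n - z * u n)"
    by (rule resolvent_setE) blast
  show "z \<notin> range V"
  proof
    assume "z \<in> range V"
    then obtain x0 where x0: "V x0 = z" by blast
    define \<epsilon> where "\<epsilon> = 1 / (K + 1)"
    have \<epsilon>: "0 < \<epsilon>" "K * \<epsilon> < 1" using K(1) by (auto simp: \<epsilon>_def field_simps)
    obtain \<delta> where \<delta>: "0 < \<delta>" "\<And>x. dist x x0 < \<delta> \<Longrightarrow> dist (V x) z < \<epsilon>"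
      using cont \<epsilon>(1) x0 unfolding continuous_on_iff by (metis UNIV_I)
    obtain k m where k: "m \<in> int_lattice" "dist (of_int k *\<^sub>R \<alpha> + m) (x0 - \<theta>) < \<delta>"
      using orbit_dense_mod_lattice[OF ri \<delta>(1)] by metis
    have "dist (\<theta> + of_int k *\<^sub>R \<alpha> + m) x0 < \<delta>" using k(2) by (simp add: dist_norm algebra_simps)
    then have c: "cmod (V (\<theta> + of_int k *\<^sub>R \<alpha>) - z) < \<epsilon>"
      using \<delta>(2)[of "\<theta> + of_int k *\<^sub>R \<alpha> + m"] lattice_periodicD[OF per k(1)] by (simp add: dist_norm)
    define c where "c = V (\<theta> + of_int k *\<^sub>R \<alpha>) - z"
    let ?d = "\<lambda>n. H_op V \<alpha> 0 \<theta> (unit_seq k) n - z * unit_seq k n"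
    have "?d n = c * unit_seq k n" for n by (simp add: H_op_def unit_seq_def c_def)
    then have "cmod (?d n) \<le> cmod c * cmod (unit_seq k n)" for n by (simp add: norm_mult)
    from ell2_dominated[OF unit_seq_ell2 this]
    have d: "?d \<in> ell2" "ell2_norm ?d \<le> cmod c" by (auto simp: ell2_norm_unit_seq)
    have "1 \<le> K * ell2_norm ?d"
      using K(2)[OF unit_seq_ell2 d(1)] by (simp add: ell2_norm_unit_seq)
    also have "\<dots> \<le> K * \<epsilon>" using d(2) c unfolding c_def by (intro mult_left_mono K(1)) simp
    finally show False using \<epsilon>(2) by simp
  qed
qed

end

section \<open>The spectrum\<close>

theorem theorem1p4:
  fixes V :: "real ^ 'd \<Rightarrow> complex" and \<alpha> :: "real ^ 'd" and l :: complex
  assumes "rationally_independent \<alpha>"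
    and "torus_function V"
    and "continuous_on UNIV V"
    and "holder_continuous V"
    and "\<And>z. log_dist_integrable V z"
  shows "\<forall>\<theta>. op_spectrum (H_op V \<alpha> l \<theta>) = S_set V l"
proof
  fix \<theta> :: "real ^ 'd"
  have per: "lattice_periodic V"
    using assms(2) by (simp add: torus_function_def lattice_periodic_def)
  note prems = assms(1) per assms(3)
  have "z \<in> resolvent_set (H_op V \<alpha> l \<theta>) \<longleftrightarrow> z \<notin> S_set V l" for z
  proof (cases "l = 0")
    case True
    then show ?thesis using spectrum_multiplication[OF prems] by (simp add: S_set_def)
  next
    case False
    then show ?thesis
      using resolvent_if_G_less[OF prems False assms(5), of z \<theta>]
        resolvent_if_G_greater[OF prems False, of z \<theta>]
        spectrum_on_range[OF prems False assms(5), of z \<theta>]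
        spectrum_critical[OF prems False, of z \<theta>]
      unfolding S_set_def P_set_def C_set_def
      by (cases "G V z" "ln (cmod l)" rule: linorder_cases) auto
  qed
  then show "op_spectrum (H_op V \<alpha> l \<theta>) = S_set V l"
    by (auto simp: op_spectrum_def)
qed

end
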